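(* Let $(C,\gamma,R,\alpha)$ be a Rota-Baxter Hom-Lie coalgebra of weight $\lambda\in\mathbb{F}$. Define $$\tilde\gamma=\lambda\gamma,\qquad \tilde\Delta=(R\otimes I)\circ\gamma .$$ Then $(C,\tilde\Delta,\tilde\gamma,\alpha)$ is a post-Hom-Lie coalgebra (with Hom-Lie cobracket $\tilde\gamma$).
   Context: All vector spaces are over a field $\mathbb{F}$ of characteristic $0$; $I$ is the identity map, $\tau(x\otimes y)=y\otimes x$, $\xi(x\otimes y\otimes z)=y\otimes z\otimes x$, $\xi^2(x\otimes y\otimes z)=z\otimes x\otimes y$. A Hom-Lie coalgebra $(C,\gamma,\alpha)$ is a vector space $C$ with linear maps $\gamma:C\to C\otimes C$, $\alpha:C\to C$ satisfying conditions (i) and (ii) below. A Rota-Baxter Hom-Lie coalgebra $(C,\gamma,R,\alpha)$ of weight $\lambda$ is a Hom-Lie coalgebra $(C,\gamma,\alpha)$ with a linear map $R:C\to C$ such that $R\circ\alpha=\alpha\circ R$ and $(R\otimes R)\circ\gamma=\big((R\otimes I)\circ\gamma+(I\otimes R)\circ\gamma+\lambda\gamma\big)\circ R$. A post-Hom-Lie coalgebra $(C,\Delta,\gamma,\alpha)$ is a vector space $C$ with linear maps $\Delta,\gamma:C\to C\otimes C$ and $\alpha:C\to C$ such that (i) $\gamma=-\tau\circ\gamma$ and $\gamma\circ\alpha=(\alpha\otimes\alpha)\circ\gamma$; (ii) $(1+\xi+\xi^2)\circ(\alpha\otimes\gamma)\circ\gamma=0$; (iii) $(\alpha\otimes\gamma)\circ\Delta-(\Delta\otimes\alpha)\circ\gamma-(\tau\otimes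 I)\circ(\alpha\otimes\Delta)\circ\gamma=0$; (iv) $(\Delta\otimes\alpha)\circ\Delta-(\alpha\otimes\Delta)\circ\Delta-(\tau\otimes I)\circ(\Delta\otimes\alpha)\circ\Delta+(\tau\otimes I)\circ(\alpha\otimes\Delta)\circ\Delta+(\gamma\otimes\alpha)\circ\Delta=0$. *)

theory Defs
  imports "Jordan_Normal_Form.Missing_VectorSpace" "HOL-Algebra.AbelCoset"
begin

section \<open>Tensor products of vector spaces\<close>

text \<open>$V \otimes W$ is the free module on $V \times W$ modulo the submodule spanned by the
  bilinearity relations. The ring fields \<open>mult\<close> and \<open>one\<close> of the module records
  are irrelevant.\<close>

definition free_module :: "('f, 'm) ring_scheme \<Rightarrow> 's set \<Rightarrow> ('f, 's \<Rightarrow> 'f) module"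
  where "free_module F S =
    \<lparr>carrier = {f. (\<forall>s. f s \<in> carrier F) \<and> (\<forall>s. s \<notin> S \<longrightarrow> f s = \<zero>\<^bsub>F\<^esub>) \<and> finite {s. f s \<noteq> \<zero>\<^bsub>F\<^esub>}},
     mult = (\<lambda>f g. undefined), one = undefined,
     zero = (\<lambda>s. \<zero>\<^bsub>F\<^esub>), add = (\<lambda>f g s. f s \<oplus>\<^bsub>F\<^esub> g s), smult = (\<lambda>a f s. a \<otimes>\<^bsub>F\<^esub> f s)\<rparr>"

definition free_gen :: "('f, 'm) ring_scheme \<Rightarrow> 's \<Rightarrow> 's \<Rightarrow> 'f"
  where "free_gen F s = (\<lambda>t. if t = s then \<one>\<^bsub>F\<^esub> else \<zero>\<^bsub>F\<^esub>)"

definition quotient_module :: "('f, 'm) ring_scheme \<Rightarrow> ('f, 'v, 'n) module_scheme \<Rightarrow> 'v set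
    \<Rightarrow> ('f, 'v set) module"
  where "quotient_module F M N =
    \<lparr>carrier = a_rcosets\<^bsub>M\<^esub> N,
     mult = (\<lambda>X Y. undefined), one = undefined,
     zero = N, add = (\<lambda>X Y. X <+>\<^bsub>M\<^esub> Y), smult = (\<lambda>a X. N <+>\<^bsub>M\<^esub> (\<lambda>x. a \<odot>\<^bsub>M\<^esub> x) ` X)\<rparr>"

definition tensor_rels :: "('f, 'm) ring_scheme \<Rightarrow> ('f, 'v, 'n) module_scheme
    \<Rightarrow> ('f, 'w, 'k) module_scheme \<Rightarrow> ('v \<times> 'w \<Rightarrow> 'f) set"
  where "tensor_rels F V W =
    (let M = free_module F (carrier V \<times> carrier W); d = free_gen F in
      {d (v \<oplus>\<^bsub>V\<^esub> v', w) \<ominus>\<^bsub>M\<^esub> (d (v, w) \<oplus>\<^bsub>M\<^esub> d (v', w)) | v v' w.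
          v \<in> carrier V \<and> v' \<in> carrier V \<and> w \<in> carrier W}
    \<union> {d (v, w \<oplus>\<^bsub>W\<^esub> w') \<ominus>\<^bsub>M\<^esub> (d (v, w) \<oplus>\<^bsub>M\<^esub> d (v, w')) | v w w'.
          v \<in> carrier V \<and> w \<in> carrier W \<and> w' \<in> carrier W}
    \<union> {d (a \<odot>\<^bsub>V\<^esub> v, w) \<ominus>\<^bsub>M\<^esub> a \<odot>\<^bsub>M\<^esub> d (v, w) | a v w.
          a \<in> carrier F \<and> v \<in> carrier V \<and> w \<in> carrier W}
    \<union> {d (v, a \<odot>\<^bsub>W\<^esub> w) \<ominus>\<^bsub>M\<^esub> a \<odot>\<^bsub>M\<^esub> d (v, w) | a v w.
          a \<in> carrier F \<and> v \<in> carrier V \<and> w \<in> carrier W})"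

definition tensor_null :: "('f, 'm) ring_scheme \<Rightarrow> ('f, 'v, 'n) module_scheme
    \<Rightarrow> ('f, 'w, 'k) module_scheme \<Rightarrow> ('v \<times> 'w \<Rightarrow> 'f) set"
  where "tensor_null F V W =
    LinearCombinations.module.span F (free_module F (carrier V \<times> carrier W)) (tensor_rels F V W)"

definition tensor :: "('f, 'm) ring_scheme \<Rightarrow> ('f, 'v, 'n) module_scheme
    \<Rightarrow> ('f, 'w, 'k) module_scheme \<Rightarrow> ('f, ('v \<times> 'w \<Rightarrow> 'f) set) module"
  where "tensor F V W =
    quotient_module F (free_module F (carrier V \<times> carrier W)) (tensor_null F V W)"

text \<open>The element $v \otimes w$ of $V \otimes W$.\<close>

definition tens :: "('f, 'm) ring_scheme \<Rightarrow> ('f, 'v, 'n) module_scheme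
    \<Rightarrow> ('f, 'w, 'k) module_scheme \<Rightarrow> 'v \<Rightarrow> 'w \<Rightarrow> ('v \<times> 'w \<Rightarrow> 'f) set"
  where "tens F V W v w =
    tensor_null F V W +>\<^bsub>free_module F (carrier V \<times> carrier W)\<^esub> free_gen F (v, w)"

text \<open>The linear map $V \otimes W \to U$ induced by a bilinear map $\varphi : V \times W \to U$;
  its existence and uniqueness are shown in \<open>tensor_lift_unique\<close> below. The condition
  \<^const>\<open>extensional\<close> only fixes the irrelevant values outside the carrier.\<close>

definition tensor_lift :: "('f, 'm) ring_scheme \<Rightarrow> ('f, 'v, 'n) module_scheme
    \<Rightarrow> ('f, 'w, 'k) module_scheme \<Rightarrow> ('f, 'u, 'l) module_scheme
    \<Rightarrow> ('v \<Rightarrow> 'w \<Rightarrow> 'u) \<Rightarrow> ('v \<times> 'w \<Rightarrow> 'f) set \<Rightarrow> 'u"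
  where "tensor_lift F V W U \<phi> =
    (THE h. h \<in> module_hom F (tensor F V W) U \<and> h \<in> extensional (carrier (tensor F V W)) \<and>
       (\<forall>v\<in>carrier V. \<forall>w\<in>carrier W. h (tens F V W v w) = \<phi> v w))"

text \<open>$f \otimes g : V \otimes W \to V' \otimes W'$.\<close>

definition tensor_map :: "('f, 'm) ring_scheme \<Rightarrow> ('f, 'v, 'n) module_scheme
    \<Rightarrow> ('f, 'w, 'k) module_scheme \<Rightarrow> ('f, 'v1, 'n1) module_scheme
    \<Rightarrow> ('f, 'w1, 'k1) module_scheme \<Rightarrow> ('v \<Rightarrow> 'v1) \<Rightarrow> ('w \<Rightarrow> 'w1)
    \<Rightarrow> ('v \<times> 'w \<Rightarrow> 'f) set \<Rightarrow> ('v1 \<times> 'w1 \<Rightarrow> 'f) set"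
  where "tensor_map F V W V' W' f g =
    tensor_lift F V W (tensor F V' W') (\<lambda>v w. tens F V' W' (f v) (g w))"

definition bilinear_map :: "('f, 'm) ring_scheme \<Rightarrow> ('f, 'v, 'n) module_scheme
    \<Rightarrow> ('f, 'w, 'k) module_scheme \<Rightarrow> ('f, 'u, 'l) module_scheme \<Rightarrow> ('v \<Rightarrow> 'w \<Rightarrow> 'u) \<Rightarrow> bool"
  where "bilinear_map F V W U \<phi> \<longleftrightarrow>
    (\<forall>w\<in>carrier W. (\<lambda>v. \<phi> v w) \<in> module_hom F V U) \<and>
    (\<forall>v\<in>carrier V. \<phi> v \<in> module_hom F W U)"

subsection \<open>Basic properties\<close>

lemma free_module_module:
  assumes "cring F" shows "module F (free_module F S)"
proof -
  interpret F: cring F by fact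
  have fin: "finite {s. f s \<oplus>\<^bsub>F\<^esub> g s \<noteq> \<zero>\<^bsub>F\<^esub>}" 
    if "finite {s. f s \<noteq> \<zero>\<^bsub>F\<^esub>}" "finite {s. g s \<noteq> \<zero>\<^bsub>F\<^esub>}" for f g :: "'s \<Rightarrow> _"
    by (rule finite_subset[OF _ finite_UnI[OF that]]) auto
  have fin2: "finite {s. a \<otimes>\<^bsub>F\<^esub> f s \<noteq> \<zero>\<^bsub>F\<^esub>}" 
    if "finite {s. f s \<noteq> \<zero>\<^bsub>F\<^esub>}" "a \<in> carrier F" for a and f :: "'s \<Rightarrow> _"
    by (rule finite_subset[OF _ that(1)]) (use that in auto)
  show ?thesis
  proof (rule module_criteria, goal_cases)
    case 4
    show ?case
    proof
      fix f assume f: "f \<in> carrier (free_module F S)"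
      have "finite {s. \<ominus>\<^bsub>F\<^esub> f s \<noteq> \<zero>\<^bsub>F\<^esub>}"
        by (rule finite_subset[of _ "{s. f s \<noteq> \<zero>\<^bsub>F\<^esub>}"]) (use f in \<open>auto simp: free_module_def\<close>)
      then show "\<exists>g\<in>carrier (free_module F S).
          f \<oplus>\<^bsub>free_module F S\<^esub> g = \<zero>\<^bsub>free_module F S\<^esub>"
        using f by (intro bexI[of _ "\<lambda>s. \<ominus>\<^bsub>F\<^esub> f s"]) (auto simp: free_module_def F.r_neg)
    qed
  qed (use assms in \<open>auto simp: free_module_def F.a_ac F.m_ac F.l_distr F.r_distr intro!: fin fin2\<close>)
qed

lemma coset_submodule_smult:
  assumes M: "module F M" and N: "LinearCombinations.submodule F N M"
    and a: "a \<in> carrier F" and x: "x \<in> carrier M"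
  shows "N <+>\<^bsub>M\<^esub> (\<lambda>y. a \<odot>\<^bsub>M\<^esub> y) ` (N +>\<^bsub>M\<^esub> x) = N +>\<^bsub>M\<^esub> (a \<odot>\<^bsub>M\<^esub> x)"
proof -
  interpret M: Module.module F M by fact
  interpret N: LinearCombinations.submodule F N M by fact
  have NM: "n \<in> carrier M" if "n \<in> N" for n using that N.subset by auto
  have ax: "a \<odot>\<^bsub>M\<^esub> x \<in> carrier M" using a x by simp
  show ?thesis
  proof
    show "N <+>\<^bsub>M\<^esub> (\<lambda>y. a \<odot>\<^bsub>M\<^esub> y) ` (N +>\<^bsub>M\<^esub> x) \<subseteq> N +>\<^bsub>M\<^esub> (a \<odot>\<^bsub>M\<^esub> x)"
    proof
      fix z assume "z \<in> N <+>\<^bsub>M\<^esub> (\<lambda>y. a \<odot>\<^bsub>M\<^esub> y) ` (N +>\<^bsub>M\<^esub> x)"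
      then obtain m n where mn: "m \<in> N" "n \<in> N" "z = m \<oplus>\<^bsub>M\<^esub> a \<odot>\<^bsub>M\<^esub> (n \<oplus>\<^bsub>M\<^esub> x)"
        by (auto simp: set_add_def' a_r_coset_def')
      have "z = (m \<oplus>\<^bsub>M\<^esub> a \<odot>\<^bsub>M\<^esub> n) \<oplus>\<^bsub>M\<^esub> a \<odot>\<^bsub>M\<^esub> x"
        using mn a x NM by (simp add: M.smult_r_distr M.a_assoc)
      moreover have "m \<oplus>\<^bsub>M\<^esub> a \<odot>\<^bsub>M\<^esub> n \<in> N" using mn a by blast
      ultimately show "z \<in> N +>\<^bsub>M\<^esub> (a \<odot>\<^bsub>M\<^esub> x)" by (auto simp: a_r_coset_def')
    qed
    show "N +>\<^bsub>M\<^esub> (a \<odot>\<^bsub>M\<^esub> x) \<subseteq> N <+>\<^bsub>M\<^esub> (\<lambda>y. a \<odot>\<^bsub>M\<^esub> y) ` (N +>\<^bsub>M\<^esub> x)"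
    proof
      fix z assume "z \<in> N +>\<^bsub>M\<^esub> (a \<odot>\<^bsub>M\<^esub> x)"
      then obtain n where n: "n \<in> N" "z = n \<oplus>\<^bsub>M\<^esub> a \<odot>\<^bsub>M\<^esub> x" by (auto simp: a_r_coset_def')
      moreover have "x \<in> N +>\<^bsub>M\<^esub> x"
        using x by (auto simp: a_r_coset_def' intro!: bexI[of _ "\<zero>\<^bsub>M\<^esub>"])
      ultimately show "z \<in> N <+>\<^bsub>M\<^esub> (\<lambda>y. a \<odot>\<^bsub>M\<^esub> y) ` (N +>\<^bsub>M\<^esub> x)"
        by (auto simp: set_add_def')
    qed
  qed
qed

lemma submodule_abelian_subgroup:
  assumes M: "module F M" and N: "LinearCombinations.submodule F N M"
  shows "abelian_subgroup N M"
proof -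
  interpret M: Module.module F M by fact
  interpret N: LinearCombinations.submodule F N M by fact
  have "\<ominus>\<^bsub>M\<^esub> n \<in> N" if "n \<in> N" for n
    using N.smult_closed[of "\<ominus>\<^bsub>F\<^esub> \<one>\<^bsub>F\<^esub>" n] that N.subset M.smult_l_minus[of "\<one>\<^bsub>F\<^esub>" n]
    by (metis M.R.add.inv_closed M.R.one_closed M.smult_one subsetD)
  moreover have "N \<noteq> {}" using N.zero_closed by force
  ultimately have "subgroup N (add_monoid M)"
    using N.subset by (intro M.add.subgroupI) auto
  then show ?thesis
    by (intro abelian_subgroupI3 additive_subgroup.intro M.abelian_group_axioms)
qed

lemma quotient_module_module:
  assumes M: "module F M" and N: "LinearCombinations.submodule F N M"
  shows "module F (quotient_module F M N)"
    and "(\<lambda>x. N +>\<^bsub>M\<^esub> x) \<in> module_hom F M (quotient_module F M N)"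
    and "carrier (quotient_module F M N) = (\<lambda>x. N +>\<^bsub>M\<^esub> x) ` carrier M"
proof -
  interpret M: Module.module F M by fact
  interpret N: LinearCombinations.submodule F N M by fact
  interpret S: abelian_subgroup N M using submodule_abelian_subgroup[OF M N] .
  let ?Q = "quotient_module F M N" and ?p = "\<lambda>x. N +>\<^bsub>M\<^esub> x"
  show car: "carrier ?Q = ?p ` carrier M"
    by (auto simp: quotient_module_def A_RCOSETS_def')
  have add: "?p x \<oplus>\<^bsub>?Q\<^esub> ?p y = ?p (x \<oplus>\<^bsub>M\<^esub> y)" if "x \<in> carrier M" "y \<in> carrier M" for x y
    using that by (simp add: quotient_module_def S.a_rcos_sum)
  have smult: "a \<odot>\<^bsub>?Q\<^esub> ?p x = ?p (a \<odot>\<^bsub>M\<^esub> x)" if "a \<in> carrier F" "x \<in> carrier M" for a x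
    using that by (simp add: quotient_module_def coset_submodule_smult[OF M N])
  have zero: "\<zero>\<^bsub>?Q\<^esub> = ?p \<zero>\<^bsub>M\<^esub>"
    using N.subset by (simp add: quotient_module_def M.a_coset_add_zero)
  show "?p \<in> module_hom F M ?Q"
    by (auto simp: module_hom_def car add smult)
  show "module F ?Q"
  proof (rule module_criteria, goal_cases)
    case 4
    show ?case
    proof
      fix X assume "X \<in> carrier ?Q"
      then obtain x where "x \<in> carrier M" "X = ?p x" by (auto simp: car)
      then show "\<exists>Y\<in>carrier ?Q. X \<oplus>\<^bsub>?Q\<^esub> Y = \<zero>\<^bsub>?Q\<^esub>"
        by (intro bexI[of _ "?p (\<ominus>\<^bsub>M\<^esub> x)"]) (auto simp: car add zero M.r_neg)
    qed
  qed (use M.R.is_cring in \<open>auto simp: car add smult zero M.a_ac M.smult_assoc1 M.smult_l_distr M.smult_r_distr\<close>)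
qed

definition free_extend :: "('f, 'm) ring_scheme \<Rightarrow> ('f, 'u, 'l) module_scheme \<Rightarrow> ('s \<Rightarrow> 'u)
    \<Rightarrow> ('s \<Rightarrow> 'f) \<Rightarrow> 'u"
  where "free_extend F U \<phi> f = (\<Oplus>\<^bsub>U\<^esub>s\<in>{s. f s \<noteq> \<zero>\<^bsub>F\<^esub>}. f s \<odot>\<^bsub>U\<^esub> \<phi> s)"

lemma free_extend_superset:
  assumes U: "module F U" and \<phi>: "\<phi> \<in> S \<rightarrow> carrier U" and f: "f \<in> carrier (free_module F S)"
    and A: "finite A" "A \<subseteq> S" "{s. f s \<noteq> \<zero>\<^bsub>F\<^esub>} \<subseteq> A"
  shows "free_extend F U \<phi> f = (\<Oplus>\<^bsub>U\<^esub>s\<in>A. f s \<odot>\<^bsub>U\<^esub> \<phi> s)"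
proof -
  interpret U: Module.module F U by fact
  have cl: "f s \<in> carrier F" for s using f by (auto simp: free_module_def)
  have cl\<phi>: "\<phi> s \<in> carrier U" if "s \<in> A" for s using that \<phi> A by auto
  show ?thesis unfolding free_extend_def
    using A by (intro U.add.finprod_mono_neutral_cong_left) (auto simp: cl cl\<phi>)
qed

lemma free_extend_hom:
  assumes U: "module F U" and \<phi>: "\<phi> \<in> S \<rightarrow> carrier U"
  shows "free_extend F U \<phi> \<in> module_hom F (free_module F S) U"
proof -
  interpret U: Module.module F U by fact
  interpret M: Module.module F "free_module F S"
    using free_module_module[OF U.R.is_cring] .
  have 1: "free_extend F U \<phi> f \<in> carrier U" if "f \<in> carrier (free_module F S)" for f
    using that \<phi> unfolding free_extend_def by (intro U.finsum_closed) (auto simp: free_module_def)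
  have 2: "free_extend F U \<phi> (f \<oplus>\<^bsub>free_module F S\<^esub> g) = free_extend F U \<phi> f \<oplus>\<^bsub>U\<^esub> free_extend F U \<phi> g"
    if f: "f \<in> carrier (free_module F S)" and g: "g \<in> carrier (free_module F S)" for f g
  proof -
    define A where "A = {s. f s \<noteq> \<zero>\<^bsub>F\<^esub>} \<union> {s. g s \<noteq> \<zero>\<^bsub>F\<^esub>}"
    have A: "finite A" "A \<subseteq> S" using f g by (auto simp: A_def free_module_def)
    have fg: "f \<oplus>\<^bsub>free_module F S\<^esub> g \<in> carrier (free_module F S)" using f g by simp
    have sub: "{s. (f \<oplus>\<^bsub>free_module F S\<^esub> g) s \<noteq> \<zero>\<^bsub>F\<^esub>} \<subseteq> A"
      by (auto simp: A_def free_module_def)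
    have cl: "f s \<in> carrier F" "g s \<in> carrier F" for s using f g by (auto simp: free_module_def)
    have cl\<phi>: "\<phi> s \<in> carrier U" if "s \<in> A" for s using that \<phi> A by auto
    have "free_extend F U \<phi> (f \<oplus>\<^bsub>free_module F S\<^esub> g)
        = (\<Oplus>\<^bsub>U\<^esub>s\<in>A. (f \<oplus>\<^bsub>free_module F S\<^esub> g) s \<odot>\<^bsub>U\<^esub> \<phi> s)"
      by (rule free_extend_superset[OF U \<phi> fg A sub])
    also have "\<dots> = (\<Oplus>\<^bsub>U\<^esub>s\<in>A. f s \<odot>\<^bsub>U\<^esub> \<phi> s \<oplus>\<^bsub>U\<^esub> g s \<odot>\<^bsub>U\<^esub> \<phi> s)"
      by (rule U.finsum_cong') (auto simp: free_module_def cl cl\<phi> U.smult_l_distr)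
    also have "\<dots> = (\<Oplus>\<^bsub>U\<^esub>s\<in>A. f s \<odot>\<^bsub>U\<^esub> \<phi> s) \<oplus>\<^bsub>U\<^esub> (\<Oplus>\<^bsub>U\<^esub>s\<in>A. g s \<odot>\<^bsub>U\<^esub> \<phi> s)"
      by (rule U.finsum_addf) (auto simp: cl cl\<phi>)
    also have "\<dots> = free_extend F U \<phi> f \<oplus>\<^bsub>U\<^esub> free_extend F U \<phi> g"
      using free_extend_superset[OF U \<phi> f A] free_extend_superset[OF U \<phi> g A]
      by (simp add: A_def)
    finally show ?thesis .
  qed
  have 3: "free_extend F U \<phi> (a \<odot>\<^bsub>free_module F S\<^esub> f) = a \<odot>\<^bsub>U\<^esub> free_extend F U \<phi> f"
    if a: "a \<in> carrier F" and f: "f \<in> carrier (free_module F S)" for a f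
  proof -
    define A where "A = {s. f s \<noteq> \<zero>\<^bsub>F\<^esub>}"
    have A: "finite A" "A \<subseteq> S" using f by (auto simp: A_def free_module_def)
    have af: "a \<odot>\<^bsub>free_module F S\<^esub> f \<in> carrier (free_module F S)" using a f by simp
    have sub: "{s. (a \<odot>\<^bsub>free_module F S\<^esub> f) s \<noteq> \<zero>\<^bsub>F\<^esub>} \<subseteq> A"
      using a by (auto simp: A_def free_module_def)
    have cl: "f s \<in> carrier F" for s using f by (auto simp: free_module_def)
    have cl\<phi>: "\<phi> s \<in> carrier U" if "s \<in> A" for s using that \<phi> A by auto
    have "free_extend F U \<phi> (a \<odot>\<^bsub>free_module F S\<^esub> f)
        = (\<Oplus>\<^bsub>U\<^esub>s\<in>A. (a \<odot>\<^bsub>free_module F S\<^esub> f) s \<odot>\<^bsub>U\<^esub> \<phi> s)"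
      by (rule free_extend_superset[OF U \<phi> af A sub])
    also have "\<dots> = (\<Oplus>\<^bsub>U\<^esub>s\<in>A. a \<odot>\<^bsub>U\<^esub> (f s \<odot>\<^bsub>U\<^esub> \<phi> s))"
      by (rule U.finsum_cong') (auto simp: free_module_def a cl cl\<phi> U.smult_assoc1)
    also have "\<dots> = a \<odot>\<^bsub>U\<^esub> (\<Oplus>\<^bsub>U\<^esub>s\<in>A. f s \<odot>\<^bsub>U\<^esub> \<phi> s)"
      by (rule U.finsum_smult_ldistr[symmetric]) (auto simp: A a cl cl\<phi>)
    finally show ?thesis by (simp add: A_def free_extend_def)
  qed
  show ?thesis using 1 2 3 by (auto simp: module_hom_def)
qed

lemma free_gen_closed:
  assumes "field F" "s \<in> S" shows "free_gen F s \<in> carrier (free_module F S)"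
proof -
  interpret F: field F by fact
  show ?thesis using assms(2) by (auto simp: free_gen_def free_module_def)
qed

lemma free_extend_gen:
  assumes F: "field F" and U: "module F U" and \<phi>: "\<phi> \<in> S \<rightarrow> carrier U" and s: "s \<in> S"
  shows "free_extend F U \<phi> (free_gen F s) = \<phi> s"
proof -
  interpret F: field F by fact
  interpret U: Module.module F U by fact
  have "{t. free_gen F s t \<noteq> \<zero>\<^bsub>F\<^esub>} = {s}" by (auto simp: free_gen_def)
  moreover have "\<phi> s \<in> carrier U" using \<phi> s by auto
  ultimately show ?thesis by (simp add: free_extend_def free_gen_def)
qed

lemma free_module_induct:
  assumes F: "field F" and T: "LinearCombinations.submodule F T (free_module F S)"
    and gen: "\<And>s. s \<in> S \<Longrightarrow> free_gen F s \<in> T"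
  shows "T = carrier (free_module F S)"
proof
  interpret F: field F by fact
  interpret T: LinearCombinations.submodule F T "free_module F S" by fact
  show "T \<subseteq> carrier (free_module F S)" by (rule T.subset)
  have "f \<in> T" if "finite A" "f \<in> carrier (free_module F S)" "{s. f s \<noteq> \<zero>\<^bsub>F\<^esub>} \<subseteq> A" for A f
    using that
  proof (induction A arbitrary: f)
    case empty
    then have "f = \<zero>\<^bsub>free_module F S\<^esub>" by (auto simp: free_module_def)
    then show ?case by simp
  next
    case (insert x A)
    show ?case
    proof (cases "x \<in> S")
      case True
      define g where "g = f(x := \<zero>\<^bsub>F\<^esub>)"
      have "finite {s. g s \<noteq> \<zero>\<^bsub>F\<^esub>}"
        by (rule finite_subset[of _ A]) (use insert in \<open>auto simp: g_def\<close>)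
      then have "g \<in> carrier (free_module F S)"
        using insert.prems by (auto simp: g_def free_module_def)
      moreover have "{s. g s \<noteq> \<zero>\<^bsub>F\<^esub>} \<subseteq> A"
        using insert.prems by (auto simp: g_def split: if_splits)
      ultimately have g: "g \<in> T" by (rule insert.IH)
      have fx: "f x \<in> carrier F" using insert.prems by (auto simp: free_module_def)
      have "f = g \<oplus>\<^bsub>free_module F S\<^esub> f x \<odot>\<^bsub>free_module F S\<^esub> free_gen F x"
        using insert.prems fx by (auto simp: g_def free_module_def free_gen_def fun_eq_iff)
      then show ?thesis using g gen[OF True] fx T.m_closed T.smult_closed by metis
    next
      case False
      then show ?thesis using insert by (auto simp: free_module_def)
    qed
  qed
  then show "carrier (free_module F S) \<subseteq> T" by (force simp: free_module_def)
qed

lemma tensor_rels_subset: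
  assumes "field F" "module F V" "module F W"
  shows "tensor_rels F V W \<subseteq> carrier (free_module F (carrier V \<times> carrier W))"
proof -
  interpret F: field F by fact
  interpret V: Module.module F V by fact
  interpret W: Module.module F W by fact
  interpret M: Module.module F "free_module F (carrier V \<times> carrier W)"
    using free_module_module[OF F.is_cring] .
  note [simp] = free_gen_closed[OF assms(1)]
  show ?thesis by (auto simp: tensor_rels_def Let_def)
qed

lemma tensor_relsI:
  fixes F (structure) and V W
  defines "M \<equiv> free_module F (carrier V \<times> carrier W)"
  shows "v \<in> carrier V \<Longrightarrow> v' \<in> carrier V \<Longrightarrow> w \<in> carrier W \<Longrightarrow>
      free_gen F (v \<oplus>\<^bsub>V\<^esub> v', w) \<ominus>\<^bsub>M\<^esub> (free_gen F (v, w) \<oplus>\<^bsub>M\<^esub> free_gen F (v', w)) \<in> tensor_rels F V W"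
    and "v \<in> carrier V \<Longrightarrow> w \<in> carrier W \<Longrightarrow> w' \<in> carrier W \<Longrightarrow>
      free_gen F (v, w \<oplus>\<^bsub>W\<^esub> w') \<ominus>\<^bsub>M\<^esub> (free_gen F (v, w) \<oplus>\<^bsub>M\<^esub> free_gen F (v, w')) \<in> tensor_rels F V W"
    and "a \<in> carrier F \<Longrightarrow> v \<in> carrier V \<Longrightarrow> w \<in> carrier W \<Longrightarrow>
      free_gen F (a \<odot>\<^bsub>V\<^esub> v, w) \<ominus>\<^bsub>M\<^esub> a \<odot>\<^bsub>M\<^esub> free_gen F (v, w) \<in> tensor_rels F V W"
    and "a \<in> carrier F \<Longrightarrow> v \<in> carrier V \<Longrightarrow> w \<in> carrier W \<Longrightarrow>
      free_gen F (v, a \<odot>\<^bsub>W\<^esub> w) \<ominus>\<^bsub>M\<^esub> a \<odot>\<^bsub>M\<^esub> free_gen F (v, w) \<in> tensor_rels F V W"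
  unfolding tensor_rels_def M_def Let_def
     apply (rule UnI1, rule UnI1, rule UnI1, rule CollectI, intro exI conjI, rule refl; assumption)
    apply (rule UnI1, rule UnI1, rule UnI2, rule CollectI, intro exI conjI, rule refl; assumption)
   apply (rule UnI1, rule UnI2, rule CollectI, intro exI conjI, rule refl; assumption)
  apply (rule UnI2, rule CollectI, intro exI conjI, rule refl; assumption)
  done

lemma tensor_null_submodule:
  assumes "field F" "module F V" "module F W"
  shows "LinearCombinations.submodule F (tensor_null F V W) (free_module F (carrier V \<times> carrier W))"
proof -
  interpret F: field F by fact
  interpret M: Module.module F "free_module F (carrier V \<times> carrier W)"
    using free_module_module[OF F.is_cring] .
  show ?thesis unfolding tensor_null_def
    by (rule M.span_is_submodule[OF tensor_rels_subset[OF assms]])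
qed

theorem tensor_vectorspace:
  assumes "vectorspace F V" "vectorspace F W"
  shows "vectorspace F (tensor F V W)"
proof -
  interpret V: vectorspace F V by fact
  interpret W: vectorspace F W by fact
  have "module F (tensor F V W)" unfolding tensor_def
    by (intro quotient_module_module free_module_module tensor_null_submodule
          V.field_axioms V.module_axioms W.module_axioms V.R.is_cring)
  then show ?thesis by (intro vectorspace.intro V.field_axioms)
qed

lemma tensor_proj:
  assumes "vectorspace F V" "vectorspace F W"
  defines "M \<equiv> free_module F (carrier V \<times> carrier W)" and "N \<equiv> tensor_null F V W"
  shows "(\<lambda>x. N +>\<^bsub>M\<^esub> x) \<in> module_hom F M (tensor F V W)"
    and "carrier (tensor F V W) = (\<lambda>x. N +>\<^bsub>M\<^esub> x) ` carrier M"
    and "\<And>x. x \<in> N \<Longrightarrow> N +>\<^bsub>M\<^esub> x = \<zero>\<^bsub>tensor F V W\<^esub>"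
    and "\<And>x y. x \<in> carrier M \<Longrightarrow> y \<in> carrier M \<Longrightarrow> N +>\<^bsub>M\<^esub> x = N +>\<^bsub>M\<^esub> y \<Longrightarrow> x \<ominus>\<^bsub>M\<^esub> y \<in> N"
proof -
  interpret V: vectorspace F V by fact
  interpret W: vectorspace F W by fact
  have M: "module F M" unfolding M_def by (rule free_module_module[OF V.R.is_cring])
  interpret M: Module.module F M by (rule M)
  have N: "LinearCombinations.submodule F N M" unfolding M_def N_def
    by (intro tensor_null_submodule V.field_axioms V.module_axioms W.module_axioms)
  interpret S: abelian_subgroup N M using submodule_abelian_subgroup[OF M N] .
  show "(\<lambda>x. N +>\<^bsub>M\<^esub> x) \<in> module_hom F M (tensor F V W)"
    "carrier (tensor F V W) = (\<lambda>x. N +>\<^bsub>M\<^esub> x) ` carrier M"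
    using quotient_module_module[OF M N] by (simp_all add: tensor_def M_def N_def)
  show "N +>\<^bsub>M\<^esub> x = \<zero>\<^bsub>tensor F V W\<^esub>" if "x \<in> N" for x
    using S.a_rcos_const[OF that] by (simp add: tensor_def quotient_module_def N_def)
  show "x \<ominus>\<^bsub>M\<^esub> y \<in> N" if "x \<in> carrier M" "y \<in> carrier M" "N +>\<^bsub>M\<^esub> x = N +>\<^bsub>M\<^esub> y" for x y
    using that S.a_rcos_module[of y x] S.a_rcos_self[of x] by (simp add: a_minus_def)
qed

theorem tens_bilinear:
  assumes "vectorspace F V" "vectorspace F W"
  shows "bilinear_map F V W (tensor F V W) (tens F V W)"
proof -
  interpret V: vectorspace F V by fact
  interpret W: vectorspace F W by fact
  interpret T: vectorspace F "tensor F V W" using tensor_vectorspace[OF assms] .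
  let ?M = "free_module F (carrier V \<times> carrier W)"
  interpret M: Module.module F ?M using free_module_module[OF V.R.is_cring] .
  note F = V.field_axioms
  let ?p = "\<lambda>x. tensor_null F V W +>\<^bsub>?M\<^esub> x"
  interpret p: mod_hom F ?M "tensor F V W" ?p
    by (intro mod_hom.intro mod_hom_axioms.intro tensor_proj(1)[OF assms] M.module_axioms T.module_axioms)
  note g [simp] = free_gen_closed[OF F]
  have t: "tens F V W v w = ?p (free_gen F (v, w))" for v w by (simp add: tens_def)
  have rel: "?p x = ?p y" if "x \<ominus>\<^bsub>?M\<^esub> y \<in> tensor_rels F V W" "x \<in> carrier ?M" "y \<in> carrier ?M" for x y
  proof -
    have "x \<ominus>\<^bsub>?M\<^esub> y \<in> tensor_null F V W"
      using that(1) M.in_own_span[OF tensor_rels_subset[OF F V.module_axioms W.module_axioms]]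
      by (auto simp: tensor_null_def)
    from tensor_proj(3)[OF assms this] have "?p x \<ominus>\<^bsub>tensor F V W\<^esub> ?p y = \<zero>\<^bsub>tensor F V W\<^esub>"
      using that by (simp del: T.M.minus_other_side)
    then show ?thesis using that p.f_im by simp
  qed
  have 1: "tens F V W (v \<oplus>\<^bsub>V\<^esub> v') w = tens F V W v w \<oplus>\<^bsub>tensor F V W\<^esub> tens F V W v' w"
    if "v \<in> carrier V" "v' \<in> carrier V" "w \<in> carrier W" for v v' w
    using rel[of "free_gen F (v \<oplus>\<^bsub>V\<^esub> v', w)" "free_gen F (v, w) \<oplus>\<^bsub>?M\<^esub> free_gen F (v', w)"] that
      tensor_relsI[where F = F and V = V and W = W]
    by (simp add: t)
  have 2: "tens F V W v (w \<oplus>\<^bsub>W\<^esub> w') = tens F V W v w \<oplus>\<^bsub>tensor F V W\<^esub> tens F V W v w'"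
    if "v \<in> carrier V" "w' \<in> carrier W" "w \<in> carrier W" for v w w'
    using rel[of "free_gen F (v, w \<oplus>\<^bsub>W\<^esub> w')" "free_gen F (v, w) \<oplus>\<^bsub>?M\<^esub> free_gen F (v, w')"] that
      tensor_relsI[where F = F and V = V and W = W]
    by (simp add: t)
  have 3: "tens F V W (a \<odot>\<^bsub>V\<^esub> v) w = a \<odot>\<^bsub>tensor F V W\<^esub> tens F V W v w"
    if "v \<in> carrier V" "a \<in> carrier F" "w \<in> carrier W" for v a w
    using rel[of "free_gen F (a \<odot>\<^bsub>V\<^esub> v, w)" "a \<odot>\<^bsub>?M\<^esub> free_gen F (v, w)"] that
      tensor_relsI[where F = F and V = V and W = W]
    by (simp add: t)
  have 4: "tens F V W v (a \<odot>\<^bsub>W\<^esub> w) = a \<odot>\<^bsub>tensor F V W\<^esub> tens F V W v w"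
    if "v \<in> carrier V" "a \<in> carrier F" "w \<in> carrier W" for v a w
    using rel[of "free_gen F (v, a \<odot>\<^bsub>W\<^esub> w)" "a \<odot>\<^bsub>?M\<^esub> free_gen F (v, w)"] that
      tensor_relsI[where F = F and V = V and W = W]
    by (simp add: t)
  have 5: "tens F V W v w \<in> carrier (tensor F V W)"
    if "v \<in> carrier V" "w \<in> carrier W" for v w
    unfolding t using that by (intro p.f_im) simp
  show ?thesis
    by (auto simp: bilinear_map_def module_hom_def 1 2 3 4 5)
qed

lemma tensor_hom_eqI:
  assumes V: "vectorspace F V" and W: "vectorspace F W" and U: "vectorspace F U"
    and h: "h \<in> module_hom F (tensor F V W) U" and k: "k \<in> module_hom F (tensor F V W) U"
    and eq: "\<And>v w. v \<in> carrier V \<Longrightarrow> w \<in> carrier W \<Longrightarrow> h (tens F V W v w) = k (tens F V W v w)"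
    and x: "x \<in> carrier (tensor F V W)"
  shows "h x = k x"
proof -
  interpret V: vectorspace F V by fact
  interpret W: vectorspace F W by fact
  interpret U: vectorspace F U by fact
  interpret T: vectorspace F "tensor F V W" using tensor_vectorspace[OF V W] .
  let ?M = "free_module F (carrier V \<times> carrier W)"
  interpret M: Module.module F ?M using free_module_module[OF V.R.is_cring] .
  let ?p = "\<lambda>x. tensor_null F V W +>\<^bsub>?M\<^esub> x"
  interpret p: mod_hom F ?M "tensor F V W" ?p
    by (intro mod_hom.intro mod_hom_axioms.intro tensor_proj(1)[OF V W] M.module_axioms T.module_axioms)
  interpret h: mod_hom F "tensor F V W" U h
    by (intro mod_hom.intro mod_hom_axioms.intro h T.module_axioms U.module_axioms)
  interpret k: mod_hom F "tensor F V W" U k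
    by (intro mod_hom.intro mod_hom_axioms.intro k T.module_axioms U.module_axioms)
  have "{f \<in> carrier ?M. h (?p f) = k (?p f)} = carrier ?M"
  proof (rule free_module_induct[OF V.field_axioms])
    show "LinearCombinations.submodule F {f \<in> carrier ?M. h (?p f) = k (?p f)} ?M"
      using p.f_im by (intro LinearCombinations.submodule.intro M.module_axioms) auto
  qed (use eq in \<open>auto simp: tens_def free_gen_closed[OF V.field_axioms]\<close>)
  then show ?thesis using x tensor_proj(2)[OF V W] by auto
qed

theorem tensor_lift_unique:
  assumes V: "vectorspace F V" and W: "vectorspace F W" and U: "vectorspace F U"
    and \<phi>: "bilinear_map F V W U \<phi>"
  shows "\<exists>!h. h \<in> module_hom F (tensor F V W) U \<and> h \<in> extensional (carrier (tensor F V W)) \<and>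
       (\<forall>v\<in>carrier V. \<forall>w\<in>carrier W. h (tens F V W v w) = \<phi> v w)"
proof -
  interpret V: vectorspace F V by fact
  interpret W: vectorspace F W by fact
  interpret U: vectorspace F U by fact
  interpret T: vectorspace F "tensor F V W" using tensor_vectorspace[OF V W] .
  note F = V.field_axioms
  let ?M = "free_module F (carrier V \<times> carrier W)"
  interpret M: Module.module F ?M using free_module_module[OF V.R.is_cring] .
  let ?p = "\<lambda>x. tensor_null F V W +>\<^bsub>?M\<^esub> x"
  interpret p: mod_hom F ?M "tensor F V W" ?p
    by (intro mod_hom.intro mod_hom_axioms.intro tensor_proj(1)[OF V W] M.module_axioms T.module_axioms)
  let ?E = "free_extend F U (case_prod \<phi>)"
  have \<phi>c: "case_prod \<phi> \<in> carrier V \<times> carrier W \<rightarrow> carrier U"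
    using \<phi> by (auto simp: bilinear_map_def module_hom_def)
  have \<phi>_add1: "\<phi> (v \<oplus>\<^bsub>V\<^esub> v') w = \<phi> v w \<oplus>\<^bsub>U\<^esub> \<phi> v' w"
    if "v \<in> carrier V" "v' \<in> carrier V" "w \<in> carrier W" for v v' w
    using \<phi> that by (auto simp: bilinear_map_def module_hom_def)
  have \<phi>_add2: "\<phi> v (w \<oplus>\<^bsub>W\<^esub> w') = \<phi> v w \<oplus>\<^bsub>U\<^esub> \<phi> v w'"
    if "v \<in> carrier V" "w' \<in> carrier W" "w \<in> carrier W" for v w w'
    using \<phi> that by (auto simp: bilinear_map_def module_hom_def)
  have \<phi>_s1: "\<phi> (a \<odot>\<^bsub>V\<^esub> v) w = a \<odot>\<^bsub>U\<^esub> \<phi> v w"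
    if "v \<in> carrier V" "a \<in> carrier F" "w \<in> carrier W" for v a w
    using \<phi> that by (auto simp: bilinear_map_def module_hom_def)
  have \<phi>_s2: "\<phi> v (a \<odot>\<^bsub>W\<^esub> w) = a \<odot>\<^bsub>U\<^esub> \<phi> v w"
    if "v \<in> carrier V" "a \<in> carrier F" "w \<in> carrier W" for v a w
    using \<phi> that by (auto simp: bilinear_map_def module_hom_def)
  interpret E: mod_hom F ?M U ?E
    by (intro mod_hom.intro mod_hom_axioms.intro free_extend_hom[OF U.module_axioms \<phi>c]
          M.module_axioms U.module_axioms)
  have E_gen: "?E (free_gen F (v, w)) = \<phi> v w" if "v \<in> carrier V" "w \<in> carrier W" for v w
    using free_extend_gen[OF F U.module_axioms \<phi>c, of "(v, w)"] that by simp
  have \<phi>cl: "\<phi> v w \<in> carrier U" if "v \<in> carrier V" "w \<in> carrier W" for v w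
    using funcset_mem[OF \<phi>c, of "(v, w)"] that by simp
  note g [simp] = free_gen_closed[OF F]
  have "tensor_rels F V W \<subseteq> E.ker"
    by (auto simp: tensor_rels_def Let_def E.ker_def E_gen \<phi>_add1 \<phi>_add2 \<phi>_s1 \<phi>_s2 \<phi>cl)
  then have ker: "tensor_null F V W \<subseteq> E.ker" unfolding tensor_null_def
    by (rule M.span_is_subset[OF _ E.ker_is_submodule])
  have E_eq: "?E x = ?E y" if "?p x = ?p y" "x \<in> carrier ?M" "y \<in> carrier ?M" for x y
  proof -
    have "x \<ominus>\<^bsub>?M\<^esub> y \<in> E.ker" using tensor_proj(4)[OF V W] that ker by blast
    then show ?thesis using that by (simp add: E.ker_def)
  qed
  have surj: "\<exists>x\<in>carrier ?M. X = ?p x" if "X \<in> carrier (tensor F V W)" for X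
    using that tensor_proj(2)[OF V W] by auto
  define r where "r X = (SOME x. x \<in> carrier ?M \<and> ?p x = X)" for X
  have r: "r X \<in> carrier ?M \<and> ?p (r X) = X" if "X \<in> carrier (tensor F V W)" for X
  proof -
    have "\<exists>x. x \<in> carrier ?M \<and> ?p x = X" using surj[OF that] by blast
    then show ?thesis unfolding r_def by (rule someI_ex)
  qed
  define h where "h = restrict (\<lambda>X. ?E (r X)) (carrier (tensor F V W))"
  have hp: "h (?p x) = ?E x" if "x \<in> carrier ?M" for x
  proof -
    note px = p.f_im[OF that]
    have "?E (r (?p x)) = ?E x"
      by (rule E_eq[OF conjunct2[OF r[OF px]] conjunct1[OF r[OF px]] that])
    then show ?thesis unfolding h_def using px by (rule trans[OF restrict_apply', rotated])
  qed
  have h_hom: "h \<in> module_hom F (tensor F V W) U"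
  proof -
    have "h X \<in> carrier U" if "X \<in> carrier (tensor F V W)" for X
      using surj[OF that] hp E.f_im by auto
    moreover have "h (X \<oplus>\<^bsub>tensor F V W\<^esub> Y) = h X \<oplus>\<^bsub>U\<^esub> h Y"
      if XY: "X \<in> carrier (tensor F V W)" "Y \<in> carrier (tensor F V W)" for X Y
    proof -
      obtain x y where "x \<in> carrier ?M" "X = ?p x" "y \<in> carrier ?M" "Y = ?p y"
        using surj XY by metis
      then show ?thesis using hp[of "x \<oplus>\<^bsub>?M\<^esub> y"] by (simp add: hp)
    qed
    moreover have "h (a \<odot>\<^bsub>tensor F V W\<^esub> X) = a \<odot>\<^bsub>U\<^esub> h X"
      if X: "X \<in> carrier (tensor F V W)" and a: "a \<in> carrier F" for X a
    proof -
      obtain x where "x \<in> carrier ?M" "X = ?p x" using surj X by metis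
      then show ?thesis using hp[of "a \<odot>\<^bsub>?M\<^esub> x"] a by (simp add: hp)
    qed
    ultimately show ?thesis by (auto simp: module_hom_def)
  qed
  show ?thesis
  proof (rule ex1I[of _ h], intro conjI ballI)
    show hg: "h (tens F V W v w) = \<phi> v w" if "v \<in> carrier V" "w \<in> carrier W" for v w
      using that by (simp add: tens_def hp E_gen)
    show he: "h \<in> extensional (carrier (tensor F V W))" by (simp add: h_def)
    fix k assume k: "k \<in> module_hom F (tensor F V W) U \<and>
        k \<in> extensional (carrier (tensor F V W)) \<and>
        (\<forall>v\<in>carrier V. \<forall>w\<in>carrier W. k (tens F V W v w) = \<phi> v w)"
    show "k = h"
    proof (rule extensionalityI[of k "carrier (tensor F V W)" h])
      show "k X = h X" if "X \<in> carrier (tensor F V W)" for X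
        by (rule tensor_hom_eqI[OF V W U _ h_hom _ that]) (use k hg in simp_all)
    qed (use k he in simp_all)
  qed (rule h_hom)
qed

lemma tensor_lift:
  assumes V: "vectorspace F V" and W: "vectorspace F W" and U: "vectorspace F U"
    and \<phi>: "bilinear_map F V W U \<phi>"
  shows "tensor_lift F V W U \<phi> \<in> module_hom F (tensor F V W) U"
    and "\<And>v w. v \<in> carrier V \<Longrightarrow> w \<in> carrier W \<Longrightarrow>
      tensor_lift F V W U \<phi> (tens F V W v w) = \<phi> v w"
  using theI'[OF tensor_lift_unique[OF assms]] by (auto simp: tensor_lift_def)

lemma tens_closed:
  assumes "vectorspace F V" "vectorspace F W" "v \<in> carrier V" "w \<in> carrier W"
  shows "tens F V W v w \<in> carrier (tensor F V W)"
  using tens_bilinear[OF assms(1,2)] assms(3,4) by (auto simp: bilinear_map_def module_hom_def)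

lemma bilinear_map_flip:
  "bilinear_map F V W U \<phi> \<Longrightarrow> bilinear_map F W V U (\<lambda>w v. \<phi> v w)"
  by (auto simp: bilinear_map_def)

lemma bilinear_map_comp:
  assumes "bilinear_map F V' W' U \<phi>" "f \<in> module_hom F V V'" "g \<in> module_hom F W W'"
  shows "bilinear_map F V W U (\<lambda>v w. \<phi> (f v) (g w))"
  using assms by (auto simp: bilinear_map_def module_hom_def Pi_def)

lemma bilinear_map_lift:
  assumes S: "vectorspace F S" and V: "vectorspace F V" and W: "vectorspace F W"
    and U: "vectorspace F U"
    and bil: "\<And>s. s \<in> carrier S \<Longrightarrow> bilinear_map F V W U (\<psi> s)"
    and lin: "\<And>v w. v \<in> carrier V \<Longrightarrow> w \<in> carrier W \<Longrightarrow> (\<lambda>s. \<psi> s v w) \<in> module_hom F S U"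
  shows "bilinear_map F S (tensor F V W) U (\<lambda>s. tensor_lift F V W U (\<psi> s))"
proof -
  interpret S: vectorspace F S by fact
  interpret U: vectorspace F U by fact
  interpret T: vectorspace F "tensor F V W" using tensor_vectorspace[OF V W] .
  let ?L = "\<lambda>s. tensor_lift F V W U (\<psi> s)"
  note L = tensor_lift[OF V W U bil]
  have L_cl: "?L s X \<in> carrier U" if "s \<in> carrier S" "X \<in> carrier (tensor F V W)" for s X
    using L(1)[OF that(1)] that(2) by (auto simp: module_hom_def)
  have \<psi>_cl: "\<psi> s v w \<in> carrier U" if "s \<in> carrier S" "v \<in> carrier V" "w \<in> carrier W" for s v w
    using module_hom_closed[OF lin[OF that(2,3)]] that(1) by auto
  have add: "?L (s \<oplus>\<^bsub>S\<^esub> s') X = ?L s X \<oplus>\<^bsub>U\<^esub> ?L s' X"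
    if s: "s \<in> carrier S" "s' \<in> carrier S" and X: "X \<in> carrier (tensor F V W)" for s s' X
  proof (rule tensor_hom_eqI[OF V W U _ _ _ X])
    show "?L (s \<oplus>\<^bsub>S\<^esub> s') \<in> module_hom F (tensor F V W) U" using L(1) s by simp
    show "(\<lambda>X. ?L s X \<oplus>\<^bsub>U\<^esub> ?L s' X) \<in> module_hom F (tensor F V W) U"
      using L(1)[OF s(1)] L(1)[OF s(2)] L_cl s
      by (simp add: module_hom_def Pi_def U.M.a_ac U.smult_r_distr)
  qed (use L(2) s lin in \<open>simp add: module_hom_def\<close>)
  have smult: "?L (a \<odot>\<^bsub>S\<^esub> s) X = a \<odot>\<^bsub>U\<^esub> ?L s X"
    if s: "s \<in> carrier S" "a \<in> carrier F" and X: "X \<in> carrier (tensor F V W)" for s a X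
  proof (rule tensor_hom_eqI[OF V W U _ _ _ X])
    show "?L (a \<odot>\<^bsub>S\<^esub> s) \<in> module_hom F (tensor F V W) U" using L(1) s by simp
    show "(\<lambda>X. a \<odot>\<^bsub>U\<^esub> ?L s X) \<in> module_hom F (tensor F V W) U"
      using L(1)[OF s(1)] L_cl s
      by (simp add: module_hom_def Pi_def U.smult_r_distr U.smult_assoc1[symmetric] S.R.m_comm)
  qed (use L(2) s lin in \<open>simp add: module_hom_def\<close>)
  show ?thesis unfolding bilinear_map_def
    using L(1) add smult L_cl by (auto simp: module_hom_def)
qed

lemma tensor_map:
  assumes "vectorspace F V" "vectorspace F W" "vectorspace F V'" "vectorspace F W'"
    and "f \<in> module_hom F V V'" "g \<in> module_hom F W W'"
  shows "tensor_map F V W V' W' f g \<in> module_hom F (tensor F V W) (tensor F V' W')"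
    and "\<And>v w. v \<in> carrier V \<Longrightarrow> w \<in> carrier W \<Longrightarrow>
      tensor_map F V W V' W' f g (tens F V W v w) = tens F V' W' (f v) (g w)"
  unfolding tensor_map_def
  by (intro tensor_lift bilinear_map_comp[OF tens_bilinear] tensor_vectorspace assms; assumption)+


section \<open>Rota-Baxter Hom-Lie coalgebras and post-Hom-Lie coalgebras\<close>

text \<open>$\tau : V \otimes W \to W \otimes V$.\<close>

definition tensor_swap :: "('f, 'm) ring_scheme \<Rightarrow> ('f, 'v, 'n) module_scheme
    \<Rightarrow> ('f, 'w, 'k) module_scheme \<Rightarrow> ('v \<times> 'w \<Rightarrow> 'f) set \<Rightarrow> ('w \<times> 'v \<Rightarrow> 'f) set"
  where "tensor_swap F V W = tensor_lift F V W (tensor F W V) (\<lambda>v w. tens F W V w v)"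

text \<open>The triple tensor power is taken to be $(C \otimes C) \otimes C$; maps into
  $C \otimes (C \otimes C)$ are followed by the canonical isomorphism
  $x \otimes (y \otimes z) \mapsto (x \otimes y) \otimes z$.\<close>

abbreviation tensor2 :: "('f, 'm) ring_scheme \<Rightarrow> ('f, 'v, 'n) module_scheme
    \<Rightarrow> ('f, ('v \<times> 'v \<Rightarrow> 'f) set) module"
  where "tensor2 F C \<equiv> tensor F C C"

abbreviation tensor3 :: "('f, 'm) ring_scheme \<Rightarrow> ('f, 'v, 'n) module_scheme
    \<Rightarrow> ('f, (('v \<times> 'v \<Rightarrow> 'f) set \<times> 'v \<Rightarrow> 'f) set) module"
  where "tensor3 F C \<equiv> tensor F (tensor2 F C) C"

definition tens3 :: "('f, 'm) ring_scheme \<Rightarrow> ('f, 'v, 'n) module_scheme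
    \<Rightarrow> 'v \<Rightarrow> 'v \<Rightarrow> 'v \<Rightarrow> (('v \<times> 'v \<Rightarrow> 'f) set \<times> 'v \<Rightarrow> 'f) set"
  where "tens3 F C x y z = tens F (tensor2 F C) C (tens F C C x y) z"

definition tensor_assoc :: "('f, 'm) ring_scheme \<Rightarrow> ('f, 'v, 'n) module_scheme
    \<Rightarrow> ('v \<times> ('v \<times> 'v \<Rightarrow> 'f) set \<Rightarrow> 'f) set \<Rightarrow> (('v \<times> 'v \<Rightarrow> 'f) set \<times> 'v \<Rightarrow> 'f) set"
  where "tensor_assoc F C =
    tensor_lift F C (tensor2 F C) (tensor3 F C)
      (\<lambda>x. tensor_lift F C C (tensor3 F C) (\<lambda>y z. tens3 F C x y z))"

text \<open>$\xi(x \otimes y \otimes z) = y \otimes z \otimes x$.\<close>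

definition tensor_cyc :: "('f, 'm) ring_scheme \<Rightarrow> ('f, 'v, 'n) module_scheme
    \<Rightarrow> (('v \<times> 'v \<Rightarrow> 'f) set \<times> 'v \<Rightarrow> 'f) set \<Rightarrow> (('v \<times> 'v \<Rightarrow> 'f) set \<times> 'v \<Rightarrow> 'f) set"
  where "tensor_cyc F C =
    tensor_lift F (tensor2 F C) C (tensor3 F C)
      (\<lambda>p z. tensor_lift F C C (tensor3 F C) (\<lambda>x y. tens3 F C y z x) p)"

text \<open>The maps $f \otimes g$ with $f, g : C \to C$; with $f : C \to C \otimes C$, $g : C \to C$;
  and with $f : C \to C$, $g : C \to C \otimes C$, respectively.\<close>

definition map11 :: "('f, 'm) ring_scheme \<Rightarrow> ('f, 'v, 'n) module_scheme \<Rightarrow> ('v \<Rightarrow> 'v) \<Rightarrow> ('v \<Rightarrow> 'v)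
    \<Rightarrow> ('v \<times> 'v \<Rightarrow> 'f) set \<Rightarrow> ('v \<times> 'v \<Rightarrow> 'f) set"
  where "map11 F C f g = tensor_map F C C C C f g"

definition map21 :: "('f, 'm) ring_scheme \<Rightarrow> ('f, 'v, 'n) module_scheme
    \<Rightarrow> ('v \<Rightarrow> ('v \<times> 'v \<Rightarrow> 'f) set) \<Rightarrow> ('v \<Rightarrow> 'v)
    \<Rightarrow> ('v \<times> 'v \<Rightarrow> 'f) set \<Rightarrow> (('v \<times> 'v \<Rightarrow> 'f) set \<times> 'v \<Rightarrow> 'f) set"
  where "map21 F C f g = tensor_map F C C (tensor2 F C) C f g"

definition map12 :: "('f, 'm) ring_scheme \<Rightarrow> ('f, 'v, 'n) module_scheme
    \<Rightarrow> ('v \<Rightarrow> 'v) \<Rightarrow> ('v \<Rightarrow> ('v \<times> 'v \<Rightarrow> 'f) set)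
    \<Rightarrow> ('v \<times> 'v \<Rightarrow> 'f) set \<Rightarrow> (('v \<times> 'v \<Rightarrow> 'f) set \<times> 'v \<Rightarrow> 'f) set"
  where "map12 F C f g = tensor_assoc F C \<circ> tensor_map F C C C (tensor2 F C) f g"

text \<open>$\tau \otimes I$ on $C \otimes C \otimes C$.\<close>

definition swap_id :: "('f, 'm) ring_scheme \<Rightarrow> ('f, 'v, 'n) module_scheme
    \<Rightarrow> (('v \<times> 'v \<Rightarrow> 'f) set \<times> 'v \<Rightarrow> 'f) set \<Rightarrow> (('v \<times> 'v \<Rightarrow> 'f) set \<times> 'v \<Rightarrow> 'f) set"
  where "swap_id F C =
    tensor_map F (tensor2 F C) C (tensor2 F C) C (tensor_swap F C C) (\<lambda>x. x)"

lemma tensor_swap: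
  assumes "vectorspace F V" "vectorspace F W"
  shows "tensor_swap F V W \<in> module_hom F (tensor F V W) (tensor F W V)"
    and "\<And>v w. v \<in> carrier V \<Longrightarrow> w \<in> carrier W \<Longrightarrow>
      tensor_swap F V W (tens F V W v w) = tens F W V w v"
  unfolding tensor_swap_def
  by (intro tensor_lift bilinear_map_flip[OF tens_bilinear] tensor_vectorspace assms; assumption)+

lemma tens3_linear:
  assumes C: "vectorspace F C"
  shows "x \<in> carrier C \<Longrightarrow> y \<in> carrier C \<Longrightarrow> (\<lambda>z. tens3 F C x y z) \<in> module_hom F C (tensor3 F C)"
    and "x \<in> carrier C \<Longrightarrow> z \<in> carrier C \<Longrightarrow> (\<lambda>y. tens3 F C x y z) \<in> module_hom F C (tensor3 F C)"
    and "y \<in> carrier C \<Longrightarrow> z \<in> carrier C \<Longrightarrow> (\<lambda>x. tens3 F C x y z) \<in> module_hom F C (tensor3 F C)"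
proof -
  note b2 = tens_bilinear[OF C C] and b3 = tens_bilinear[OF tensor_vectorspace[OF C C] C]
  show "x \<in> carrier C \<Longrightarrow> y \<in> carrier C \<Longrightarrow> (\<lambda>z. tens3 F C x y z) \<in> module_hom F C (tensor3 F C)"
    using b3 tens_closed[OF C C] by (simp add: bilinear_map_def tens3_def)
  show "x \<in> carrier C \<Longrightarrow> z \<in> carrier C \<Longrightarrow> (\<lambda>y. tens3 F C x y z) \<in> module_hom F C (tensor3 F C)"
    using b2 b3 tens_closed[OF C C] by (simp add: bilinear_map_def tens3_def module_hom_def Pi_def)
  show "y \<in> carrier C \<Longrightarrow> z \<in> carrier C \<Longrightarrow> (\<lambda>x. tens3 F C x y z) \<in> module_hom F C (tensor3 F C)"
    using b2 b3 tens_closed[OF C C] by (simp add: bilinear_map_def tens3_def module_hom_def Pi_def)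
qed

lemma tensor_assoc:
  assumes C: "vectorspace F C"
  shows "tensor_assoc F C \<in> module_hom F (tensor F C (tensor2 F C)) (tensor3 F C)"
    and "\<And>x y z. x \<in> carrier C \<Longrightarrow> y \<in> carrier C \<Longrightarrow> z \<in> carrier C \<Longrightarrow>
      tensor_assoc F C (tens F C (tensor2 F C) x (tens F C C y z)) = tens3 F C x y z"
proof -
  note C2 = tensor_vectorspace[OF C C] and C3 = tensor_vectorspace[OF tensor_vectorspace[OF C C] C]
  have bil: "bilinear_map F C C (tensor3 F C) (\<lambda>y z. tens3 F C x y z)" if "x \<in> carrier C" for x
    using that by (simp add: bilinear_map_def tens3_linear[OF C])
  note b = bilinear_map_lift[OF C C C C3 bil tens3_linear(3)[OF C]]
  show "tensor_assoc F C \<in> module_hom F (tensor F C (tensor2 F C)) (tensor3 F C)"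
    unfolding tensor_assoc_def by (rule tensor_lift(1)[OF C C2 C3 b])
  show "tensor_assoc F C (tens F C (tensor2 F C) x (tens F C C y z)) = tens3 F C x y z"
    if "x \<in> carrier C" "y \<in> carrier C" "z \<in> carrier C" for x y z
    unfolding tensor_assoc_def
    using that by (simp add: tensor_lift(2)[OF C C2 C3 b] tensor_lift(2)[OF C C C3 bil] tens_closed[OF C C])
qed

lemma tensor_cyc:
  assumes C: "vectorspace F C"
  shows "tensor_cyc F C \<in> module_hom F (tensor3 F C) (tensor3 F C)"
    and "\<And>x y z. x \<in> carrier C \<Longrightarrow> y \<in> carrier C \<Longrightarrow> z \<in> carrier C \<Longrightarrow>
      tensor_cyc F C (tens3 F C x y z) = tens3 F C y z x"
proof -
  note C2 = tensor_vectorspace[OF C C] and C3 = tensor_vectorspace[OF tensor_vectorspace[OF C C] C]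
  have bil: "bilinear_map F C C (tensor3 F C) (\<lambda>x y. tens3 F C y z x)" if "z \<in> carrier C" for z
    using that by (simp add: bilinear_map_def tens3_linear[OF C])
  note b = bilinear_map_flip[OF bilinear_map_lift[OF C C C C3 bil tens3_linear(2)[OF C]]]
  show "tensor_cyc F C \<in> module_hom F (tensor3 F C) (tensor3 F C)"
    unfolding tensor_cyc_def by (rule tensor_lift(1)[OF C2 C C3 b])
  show "tensor_cyc F C (tens3 F C x y z) = tens3 F C y z x"
    if "x \<in> carrier C" "y \<in> carrier C" "z \<in> carrier C" for x y z
    unfolding tensor_cyc_def tens3_def[of F C x]
    using that by (simp add: tensor_lift(2)[OF C2 C C3 b] tensor_lift(2)[OF C C C3 bil] tens_closed[OF C C])
qed

locale char_0_vectorspace = vectorspace F C for F and C +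
  assumes char_0: "\<And>n::nat. n > 0 \<Longrightarrow> [n] \<cdot>\<^bsub>F\<^esub> \<one>\<^bsub>F\<^esub> \<noteq> \<zero>\<^bsub>F\<^esub>"

locale hom_lie_coalgebra = char_0_vectorspace F C for F and C +
  fixes \<gamma> and \<alpha>
  assumes linear_\<gamma>: "linear_map F C (tensor2 F C) \<gamma>"
    and linear_\<alpha>: "linear_map F C C \<alpha>"
    and antisym: "\<And>x. x \<in> carrier C \<Longrightarrow> \<gamma> x = \<ominus>\<^bsub>tensor2 F C\<^esub> tensor_swap F C C (\<gamma> x)"
    and comult: "\<And>x. x \<in> carrier C \<Longrightarrow> \<gamma> (\<alpha> x) = map11 F C \<alpha> \<alpha> (\<gamma> x)"
    and hom_jacobi: "\<And>x. x \<in> carrier C \<Longrightarrow>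
      (let y = map12 F C \<alpha> \<gamma> (\<gamma> x)
       in y \<oplus>\<^bsub>tensor3 F C\<^esub> tensor_cyc F C y \<oplus>\<^bsub>tensor3 F C\<^esub> tensor_cyc F C (tensor_cyc F C y))
        = \<zero>\<^bsub>tensor3 F C\<^esub>"

locale rota_baxter_hom_lie_coalgebra = hom_lie_coalgebra F C \<gamma> \<alpha> for F and C and \<gamma> and R and \<alpha> +
  fixes lam
  assumes weight: "lam \<in> carrier F"
    and linear_R: "linear_map F C C R"
    and R_\<alpha>: "\<And>x. x \<in> carrier C \<Longrightarrow> R (\<alpha> x) = \<alpha> (R x)"
    and rota_baxter: "\<And>x. x \<in> carrier C \<Longrightarrow>
      map11 F C R R (\<gamma> x) =
        map11 F C R (\<lambda>z. z) (\<gamma> (R x)) \<oplus>\<^bsub>tensor2 F C\<^esub> map11 F C (\<lambda>z. z) R (\<gamma> (R x))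
          \<oplus>\<^bsub>tensor2 F C\<^esub> lam \<odot>\<^bsub>tensor2 F C\<^esub> \<gamma> (R x)"

text \<open>In particular \<open>(C, \<gamma>, \<alpha>)\<close> is a Hom-Lie coalgebra.\<close>

locale post_hom_lie_coalgebra = hom_lie_coalgebra F C \<gamma> \<alpha> for F and C and \<Delta> and \<gamma> and \<alpha> +
  assumes linear_\<Delta>: "linear_map F C (tensor2 F C) \<Delta>"
    and post1: "\<And>x. x \<in> carrier C \<Longrightarrow>
      map12 F C \<alpha> \<gamma> (\<Delta> x) \<ominus>\<^bsub>tensor3 F C\<^esub> map21 F C \<Delta> \<alpha> (\<gamma> x)
        \<ominus>\<^bsub>tensor3 F C\<^esub> swap_id F C (map12 F C \<alpha> \<Delta> (\<gamma> x)) = \<zero>\<^bsub>tensor3 F C\<^esub>"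
    and post2: "\<And>x. x \<in> carrier C \<Longrightarrow>
      map21 F C \<Delta> \<alpha> (\<Delta> x) \<ominus>\<^bsub>tensor3 F C\<^esub> map12 F C \<alpha> \<Delta> (\<Delta> x)
        \<ominus>\<^bsub>tensor3 F C\<^esub> swap_id F C (map21 F C \<Delta> \<alpha> (\<Delta> x))
        \<oplus>\<^bsub>tensor3 F C\<^esub> swap_id F C (map12 F C \<alpha> \<Delta> (\<Delta> x))
        \<oplus>\<^bsub>tensor3 F C\<^esub> map21 F C \<gamma> \<alpha> (\<Delta> x) = \<zero>\<^bsub>tensor3 F C\<^esub>"

end

theory Submission
  imports Defs
begin

text \<open>Antisymmetry of \<open>\<gamma>\<close> identifies \<open>- (\<gamma> \<otimes> \<alpha>) \<circ> \<gamma>\<close> with \<open>\<xi> \<circ> (\<alpha> \<otimes> \<gamma>) \<circ> \<gamma>\<close> and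
  \<open>- (\<tau> \<otimes> I) \<circ> (\<alpha> \<otimes> \<gamma>) \<circ> \<gamma>\<close> with \<open>\<xi>\<^sup>2 \<circ> (\<alpha> \<otimes> \<gamma>) \<circ> \<gamma>\<close>, so the Hom-Jacobi identity becomes
  \<open>(\<alpha> \<otimes> \<gamma>) \<circ> \<gamma> - (\<gamma> \<otimes> \<alpha>) \<circ> \<gamma> - (\<tau> \<otimes> I) \<circ> (\<alpha> \<otimes> \<gamma>) \<circ> \<gamma> = 0\<close>. Since \<open>R\<close> commutes with
  \<open>\<alpha>\<close>, condition (iii) is this identity composed with \<open>\<lambda> (R \<otimes> I \<otimes> I)\<close>. In condition (iv) the
  three terms of the form \<open>(_ \<otimes> \<alpha>) \<circ> \<gamma>\<close> add up, by the Rota-Baxter equation, to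
  \<open>(R \<otimes> R \<otimes> I) \<circ> (\<gamma> \<otimes> \<alpha>) \<circ> \<gamma>\<close>, and the whole is the identity composed with
  \<open>- (R \<otimes> R \<otimes> I)\<close>.\<close>

section \<open>Module homomorphisms\<close>

lemma module_hom_image: "f \<in> module_hom F V W \<Longrightarrow> x \<in> carrier V \<Longrightarrow> f x \<in> carrier W"
  by (auto simp: module_hom_def)

lemma module_hom_ident: "(\<lambda>x. x) \<in> module_hom F V V"
  by (auto simp: module_hom_def)

lemma module_hom_comp:
  "g \<in> module_hom F V W \<Longrightarrow> f \<in> module_hom F U V \<Longrightarrow> (\<lambda>x. g (f x)) \<in> module_hom F U W"
  by (simp add: module_hom_def Pi_def)

lemma module_hom_plus:
  assumes "module F W" "f \<in> module_hom F V W" "g \<in> module_hom F V W"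
  shows "(\<lambda>x. f x \<oplus>\<^bsub>W\<^esub> g x) \<in> module_hom F V W"
proof -
  interpret W: Module.module F W by fact
  show ?thesis
    using assms(2,3) by (auto simp: module_hom_def Pi_def W.a_ac W.smult_r_distr)
qed

lemma module_hom_scale:
  assumes "module F W" "f \<in> module_hom F V W" "a \<in> carrier F"
  shows "(\<lambda>x. a \<odot>\<^bsub>W\<^esub> f x) \<in> module_hom F V W"
proof -
  interpret W: Module.module F W by fact
  show ?thesis
    using assms(2,3)
    by (auto simp: module_hom_def Pi_def W.smult_r_distr W.R.m_comm W.smult_assoc1[symmetric])
qed

text \<open>With the sign written as a scalar, homogeneity of linear maps is enough to move it
  through \<open>tensor_cyc\<close>, \<open>swap_id\<close> and tensor products of maps.\<close>

lemma module_uminus_smult: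
  assumes "module F W" "x \<in> carrier W"
  shows "\<ominus>\<^bsub>W\<^esub> x = (\<ominus>\<^bsub>F\<^esub> \<one>\<^bsub>F\<^esub>) \<odot>\<^bsub>W\<^esub> x"
proof -
  interpret W: Module.module F W by fact
  show ?thesis using assms(2) W.smult_l_minus[of "\<one>\<^bsub>F\<^esub>" x] by simp
qed

lemma module_hom_uminus:
  assumes V: "module F V" and W: "module F W" and f: "f \<in> module_hom F V W" and x: "x \<in> carrier V"
  shows "f (\<ominus>\<^bsub>V\<^esub> x) = \<ominus>\<^bsub>W\<^esub> f x"
proof -
  interpret V: Module.module F V by fact
  show ?thesis
    using f x module_hom_image[OF f x]
    by (simp add: module_uminus_smult[OF V] module_uminus_smult[OF W] module_hom_smult)
qed

lemma module_hom_minus: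
  assumes V: "module F V" and W: "module F W" and f: "f \<in> module_hom F V W"
    and x: "x \<in> carrier V" and y: "y \<in> carrier V"
  shows "f (x \<ominus>\<^bsub>V\<^esub> y) = f x \<ominus>\<^bsub>W\<^esub> f y"
proof -
  interpret V: Module.module F V by fact
  show ?thesis
    using x y by (simp add: a_minus_def module_hom_add[OF f] module_hom_uminus[OF V W f])
qed

lemma module_hom_zero:
  assumes V: "module F V" and W: "module F W" and f: "f \<in> module_hom F V W"
  shows "f \<zero>\<^bsub>V\<^esub> = \<zero>\<^bsub>W\<^esub>"
proof -
  interpret V: Module.module F V by fact
  interpret W: Module.module F W by fact
  have "f (\<zero>\<^bsub>F\<^esub> \<odot>\<^bsub>V\<^esub> \<zero>\<^bsub>V\<^esub>) = \<zero>\<^bsub>F\<^esub> \<odot>\<^bsub>W\<^esub> f \<zero>\<^bsub>V\<^esub>"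
    by (rule module_hom_smult[OF f]) simp_all
  then show ?thesis using module_hom_image[OF f V.M.zero_closed] by simp
qed


section \<open>Tensor products of maps\<close>

lemma tens_add_left:
  assumes "vectorspace F V" "vectorspace F W" "v \<in> carrier V" "v' \<in> carrier V" "w \<in> carrier W"
  shows "tens F V W (v \<oplus>\<^bsub>V\<^esub> v') w = tens F V W v w \<oplus>\<^bsub>tensor F V W\<^esub> tens F V W v' w"
  using tens_bilinear[OF assms(1,2)] assms(3-) by (auto simp: bilinear_map_def module_hom_def)

lemma tens_smult_left:
  assumes "vectorspace F V" "vectorspace F W" "a \<in> carrier F" "v \<in> carrier V" "w \<in> carrier W"
  shows "tens F V W (a \<odot>\<^bsub>V\<^esub> v) w = a \<odot>\<^bsub>tensor F V W\<^esub> tens F V W v w"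
  using tens_bilinear[OF assms(1,2)] assms(3-) by (auto simp: bilinear_map_def module_hom_def)

lemma tens_smult_right:
  assumes "vectorspace F V" "vectorspace F W" "a \<in> carrier F" "v \<in> carrier V" "w \<in> carrier W"
  shows "tens F V W v (a \<odot>\<^bsub>W\<^esub> w) = a \<odot>\<^bsub>tensor F V W\<^esub> tens F V W v w"
  using tens_bilinear[OF assms(1,2)] assms(3-) by (auto simp: bilinear_map_def module_hom_def)

lemma vectorspace_imp_module: "vectorspace F V \<Longrightarrow> module F V"
  by (simp add: vectorspace_def)

text \<open>The description that defines \<open>tensor_lift\<close> looks at the bilinear map only
  on the carriers, so both sides are the same description. The functions therefore agree everywhere,
  and facts known only on carrier elements (commutation with \<alpha>, antisymmetry, the Rota-Baxter
  equation) can be used inside a tensor product.\<close>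

lemma tensor_map_cong:
  assumes "\<And>v. v \<in> carrier V \<Longrightarrow> f v = f' v" "\<And>w. w \<in> carrier W \<Longrightarrow> g w = g' w"
  shows "tensor_map F V W V' W' f g = tensor_map F V W V' W' f' g'"
proof -
  have "(\<forall>v\<in>carrier V. \<forall>w\<in>carrier W. h (tens F V W v w) = tens F V' W' (f v) (g w)) \<longleftrightarrow>
    (\<forall>v\<in>carrier V. \<forall>w\<in>carrier W. h (tens F V W v w) = tens F V' W' (f' v) (g' w))" for h
    using assms by simp
  then show ?thesis unfolding tensor_map_def tensor_lift_def by simp
qed

section \<open>Functoriality and linearity of \<open>f \<otimes> g\<close>, naturality of the
  swap\<close>

context
  fixes F :: "('f, 'm) ring_scheme" and V :: "('f, 'v, 'n) module_scheme"
    and W :: "('f, 'w, 'k) module_scheme" and V' :: "('f, 'v1, 'n1) module_scheme"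
    and W' :: "('f, 'w1, 'k1) module_scheme"
  assumes V: "vectorspace F V" and W: "vectorspace F W"
    and V': "vectorspace F V'" and W': "vectorspace F W'"
begin

text \<open>Both sides are linear in \<open>X\<close> and agree on pure tensors, which determine a
  linear map by \<open>tensor_hom_eqI\<close>. The other identities between tensor maps rest on the
  same argument.\<close>

lemma tensor_map_comp:
  assumes V'': "vectorspace F V''" and W'': "vectorspace F W''"
    and f: "f \<in> module_hom F V V'" and g: "g \<in> module_hom F W W'"
    and f': "f' \<in> module_hom F V' V''" and g': "g' \<in> module_hom F W' W''"
    and X: "X \<in> carrier (tensor F V W)"
  shows "tensor_map F V' W' V'' W'' f' g' (tensor_map F V W V' W' f g X) =
    tensor_map F V W V'' W'' (\<lambda>v. f' (f v)) (\<lambda>w. g' (g w)) X"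
proof -
  note a = tensor_map[OF V W V' W' f g] and b = tensor_map[OF V' W' V'' W'' f' g']
    and c = tensor_map[OF V W V'' W'' module_hom_comp[OF f' f] module_hom_comp[OF g' g]]
  show ?thesis
    by (rule tensor_hom_eqI[OF V W tensor_vectorspace[OF V'' W''] module_hom_comp[OF b(1) a(1)] c(1) _ X])
      (simp add: a(2) b(2) c(2) module_hom_image[OF f] module_hom_image[OF g])
qed

lemma tensor_map_add_left:
  assumes f: "f \<in> module_hom F V V'" and f': "f' \<in> module_hom F V V'" and g: "g \<in> module_hom F W W'"
    and X: "X \<in> carrier (tensor F V W)"
  shows "tensor_map F V W V' W' (\<lambda>v. f v \<oplus>\<^bsub>V'\<^esub> f' v) g X =
    tensor_map F V W V' W' f g X \<oplus>\<^bsub>tensor F V' W'\<^esub> tensor_map F V W V' W' f' g X"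
proof -
  note T = tensor_vectorspace[OF V' W']
  note a = tensor_map[OF V W V' W' f g] and b = tensor_map[OF V W V' W' f' g]
    and c = tensor_map[OF V W V' W' module_hom_plus[OF vectorspace_imp_module[OF V'] f f'] g]
  show ?thesis
    by (rule tensor_hom_eqI[OF V W T c(1) module_hom_plus[OF vectorspace_imp_module[OF T] a(1) b(1)] _ X])
      (simp add: a(2) b(2) c(2) module_hom_image[OF f] module_hom_image[OF f'] module_hom_image[OF g]
         tens_add_left[OF V' W'])
qed

lemma tensor_map_smult_left:
  assumes k: "k \<in> carrier F" and f: "f \<in> module_hom F V V'" and g: "g \<in> module_hom F W W'"
    and X: "X \<in> carrier (tensor F V W)"
  shows "tensor_map F V W V' W' (\<lambda>v. k \<odot>\<^bsub>V'\<^esub> f v) g X =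
    k \<odot>\<^bsub>tensor F V' W'\<^esub> tensor_map F V W V' W' f g X"
proof -
  note T = tensor_vectorspace[OF V' W']
  note a = tensor_map[OF V W V' W' f g]
    and c = tensor_map[OF V W V' W' module_hom_scale[OF vectorspace_imp_module[OF V'] f k] g]
  show ?thesis
    by (rule tensor_hom_eqI[OF V W T c(1) module_hom_scale[OF vectorspace_imp_module[OF T] a(1) k] _ X])
      (simp add: a(2) c(2) module_hom_image[OF f] module_hom_image[OF g] tens_smult_left[OF V' W'] k)
qed

lemma tensor_map_smult_right:
  assumes k: "k \<in> carrier F" and f: "f \<in> module_hom F V V'" and g: "g \<in> module_hom F W W'"
    and X: "X \<in> carrier (tensor F V W)"
  shows "tensor_map F V W V' W' f (\<lambda>w. k \<odot>\<^bsub>W'\<^esub> g w) X =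
    k \<odot>\<^bsub>tensor F V' W'\<^esub> tensor_map F V W V' W' f g X"
proof -
  note T = tensor_vectorspace[OF V' W']
  note a = tensor_map[OF V W V' W' f g]
    and c = tensor_map[OF V W V' W' f module_hom_scale[OF vectorspace_imp_module[OF W'] g k]]
  show ?thesis
    by (rule tensor_hom_eqI[OF V W T c(1) module_hom_scale[OF vectorspace_imp_module[OF T] a(1) k] _ X])
      (simp add: a(2) c(2) module_hom_image[OF f] module_hom_image[OF g] tens_smult_right[OF V' W'] k)
qed

lemma tensor_swap_tensor_map:
  assumes f: "f \<in> module_hom F V V'" and g: "g \<in> module_hom F W W'"
    and X: "X \<in> carrier (tensor F V W)"
  shows "tensor_swap F V' W' (tensor_map F V W V' W' f g X) =
    tensor_map F W V W' V' g f (tensor_swap F V W X)"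
proof -
  note a = tensor_map[OF V W V' W' f g] and b = tensor_map[OF W V W' V' g f]
    and s = tensor_swap[OF V W] and s' = tensor_swap[OF V' W']
  show ?thesis
    by (rule tensor_hom_eqI[OF V W tensor_vectorspace[OF W' V']
          module_hom_comp[OF s'(1) a(1)] module_hom_comp[OF b(1) s(1)] _ X])
      (simp add: a(2) b(2) s(2) s'(2) module_hom_image[OF f] module_hom_image[OF g])
qed

end


section \<open>Maps on the tensor powers of one space\<close>

text \<open>Taken with \<open>R\<close>, \<open>R\<close> and the identity, or with \<open>R\<close>
  in one factor only, these are the operators that turn the Hom-Jacobi identity into conditions (iv)
  and (iii).\<close>

definition map111 :: "('f, 'm) ring_scheme \<Rightarrow> ('f, 'v, 'n) module_scheme
    \<Rightarrow> ('v \<Rightarrow> 'v) \<Rightarrow> ('v \<Rightarrow> 'v) \<Rightarrow> ('v \<Rightarrow> 'v)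
    \<Rightarrow> (('v \<times> 'v \<Rightarrow> 'f) set \<times> 'v \<Rightarrow> 'f) set \<Rightarrow> (('v \<times> 'v \<Rightarrow> 'f) set \<times> 'v \<Rightarrow> 'f) set"
  where "map111 F C f g h = tensor_map F (tensor2 F C) C (tensor2 F C) C (map11 F C f g) h"

context
  fixes F :: "('f, 'm) ring_scheme" and C :: "('f, 'c, 'n) module_scheme"
  assumes C: "vectorspace F C"
begin

private lemmas C2 = tensor_vectorspace[OF C C]
private lemmas C3 = tensor_vectorspace[OF C2 C]

lemma map11_hom:
  "f \<in> module_hom F C C \<Longrightarrow> g \<in> module_hom F C C \<Longrightarrow>
    map11 F C f g \<in> module_hom F (tensor2 F C) (tensor2 F C)"
  unfolding map11_def by (rule tensor_map(1)[OF C C C C])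

lemma map21_hom:
  "f \<in> module_hom F C (tensor2 F C) \<Longrightarrow> g \<in> module_hom F C C \<Longrightarrow>
    map21 F C f g \<in> module_hom F (tensor2 F C) (tensor3 F C)"
  unfolding map21_def by (rule tensor_map(1)[OF C C C2 C])

lemma map12_hom:
  "f \<in> module_hom F C C \<Longrightarrow> g \<in> module_hom F C (tensor2 F C) \<Longrightarrow>
    map12 F C f g \<in> module_hom F (tensor2 F C) (tensor3 F C)"
  unfolding map12_def comp_def
  by (rule module_hom_comp[OF tensor_assoc(1)[OF C] tensor_map(1)[OF C C C C2]])

lemma map111_hom:
  "f \<in> module_hom F C C \<Longrightarrow> g \<in> module_hom F C C \<Longrightarrow> h \<in> module_hom F C C \<Longrightarrow>
    map111 F C f g h \<in> module_hom F (tensor3 F C) (tensor3 F C)"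
  unfolding map111_def by (rule tensor_map(1)[OF C2 C C2 C map11_hom])

lemma swap_id_hom: "swap_id F C \<in> module_hom F (tensor3 F C) (tensor3 F C)"
  unfolding swap_id_def
  by (rule tensor_map(1)[OF C2 C C2 C tensor_swap(1)[OF C C] module_hom_ident])

lemma map11_ident:
  assumes "X \<in> carrier (tensor2 F C)"
  shows "map11 F C (\<lambda>x. x) (\<lambda>x. x) X = X"
  unfolding map11_def
  by (rule tensor_hom_eqI[OF C C C2 tensor_map(1)[OF C C C C] module_hom_ident _ assms])
    (simp_all add: module_hom_ident tensor_map(2)[OF C C C C])

section \<open>Composition laws for tensor maps of the various shapes\<close>

lemma map21_map11:
  assumes "f \<in> module_hom F C (tensor2 F C)" "g \<in> module_hom F C C"
    and "h \<in> module_hom F C C" "k \<in> module_hom F C C" "X \<in> carrier (tensor2 F C)"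
  shows "map21 F C f g (map11 F C h k X) = map21 F C (\<lambda>x. f (h x)) (\<lambda>x. g (k x)) X"
  unfolding map21_def map11_def by (rule tensor_map_comp[OF C C C C C2 C assms(3,4,1,2,5)])

lemma map12_map11:
  assumes "f \<in> module_hom F C C" "g \<in> module_hom F C (tensor2 F C)"
    and "h \<in> module_hom F C C" "k \<in> module_hom F C C" "X \<in> carrier (tensor2 F C)"
  shows "map12 F C f g (map11 F C h k X) = map12 F C (\<lambda>x. f (h x)) (\<lambda>x. g (k x)) X"
  unfolding map12_def map11_def comp_def
  by (simp add: tensor_map_comp[OF C C C C C C2 assms(3,4,1,2,5)])

lemma map111_map21:
  assumes "f \<in> module_hom F C C" "g \<in> module_hom F C C" "h \<in> module_hom F C C"
    and "d \<in> module_hom F C (tensor2 F C)" "a \<in> module_hom F C C" "X \<in> carrier (tensor2 F C)"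
  shows "map111 F C f g h (map21 F C d a X) =
    map21 F C (\<lambda>x. map11 F C f g (d x)) (\<lambda>x. h (a x)) X"
  unfolding map111_def map21_def
  by (rule tensor_map_comp[OF C C C2 C C2 C assms(4,5) map11_hom[OF assms(1,2)] assms(3,6)])

lemma swap_id_map21:
  assumes "d \<in> module_hom F C (tensor2 F C)" "a \<in> module_hom F C C" "X \<in> carrier (tensor2 F C)"
  shows "swap_id F C (map21 F C d a X) = map21 F C (\<lambda>x. tensor_swap F C C (d x)) a X"
  unfolding swap_id_def map21_def
  by (rule tensor_map_comp[OF C C C2 C C2 C assms(1,2) tensor_swap(1)[OF C C] module_hom_ident assms(3)])

lemma tensor_assoc_natural:
  assumes f: "f \<in> module_hom F C C" and g: "g \<in> module_hom F C C" and h: "h \<in> module_hom F C C"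
    and X: "X \<in> carrier (tensor F C (tensor2 F C))"
  shows "map111 F C f g h (tensor_assoc F C X) =
    tensor_assoc F C (tensor_map F C (tensor2 F C) C (tensor2 F C) f (map11 F C g h) X)"
proof (rule tensor_hom_eqI[OF C C2 C3 _ _ _ X])
  note m = tensor_map[OF C C2 C C2 f map11_hom[OF g h]] and a = tensor_assoc[OF C]
  show lhs: "(\<lambda>X. map111 F C f g h (tensor_assoc F C X))
      \<in> module_hom F (tensor F C (tensor2 F C)) (tensor3 F C)"
    by (rule module_hom_comp[OF map111_hom[OF f g h] a(1)])
  show rhs: "(\<lambda>X. tensor_assoc F C (tensor_map F C (tensor2 F C) C (tensor2 F C) f (map11 F C g h) X))
      \<in> module_hom F (tensor F C (tensor2 F C)) (tensor3 F C)"
    by (rule module_hom_comp[OF a(1) m(1)])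
  fix x w assume x: "x \<in> carrier C" and w: "w \<in> carrier (tensor2 F C)"
  \<comment> \<open>Agreement on \<open>x \<otimes> w\<close> is still a statement about an
    arbitrary \<open>w\<close> in \<open>C \<otimes> C\<close>. Since \<open>w\<close> enters
    linearly for fixed \<open>x\<close>, a second reduction to pure tensors
    \<open>y \<otimes> z\<close> is possible.\<close>
  note t = bspec[OF conjunct2[OF tens_bilinear[OF C C2, unfolded bilinear_map_def]] x]
  show "map111 F C f g h (tensor_assoc F C (tens F C (tensor2 F C) x w)) =
    tensor_assoc F C (tensor_map F C (tensor2 F C) C (tensor2 F C) f (map11 F C g h)
      (tens F C (tensor2 F C) x w))"
  proof (rule tensor_hom_eqI[OF C C C3 module_hom_comp[OF lhs t] module_hom_comp[OF rhs t] _ w])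
    fix y z assume yz: "y \<in> carrier C" "z \<in> carrier C"
    note cl = module_hom_image[OF f] module_hom_image[OF g] module_hom_image[OF h] tens_closed[OF C C]
    show "map111 F C f g h (tensor_assoc F C (tens F C (tensor2 F C) x (tens F C C y z))) =
      tensor_assoc F C (tensor_map F C (tensor2 F C) C (tensor2 F C) f (map11 F C g h)
        (tens F C (tensor2 F C) x (tens F C C y z)))"
      using x yz cl
      by (simp add: m(2) a(2) tens3_def map111_def tensor_map(2)[OF C2 C C2 C map11_hom[OF f g] h])
        (simp add: map11_def tensor_map(2)[OF C C C C f g] tensor_map(2)[OF C C C C g h]
          a(2)[unfolded tens3_def])
  qed
qed

text \<open>\<open>map12\<close> ends with the associativity isomorphism. By its naturality the
  operator on the left passes through and becomes \<open>f \<otimes> (g \<otimes> h)\<close>, where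
  functoriality applies.\<close>

lemma map111_map12:
  assumes "f \<in> module_hom F C C" "g \<in> module_hom F C C" "h \<in> module_hom F C C"
    and "a \<in> module_hom F C C" "d \<in> module_hom F C (tensor2 F C)" "X \<in> carrier (tensor2 F C)"
  shows "map111 F C f g h (map12 F C a d X) =
    map12 F C (\<lambda>x. f (a x)) (\<lambda>x. map11 F C g h (d x)) X"
  unfolding map12_def comp_def
  using module_hom_image[OF tensor_map(1)[OF C C C C2 assms(4,5)] assms(6)]
  by (simp add: tensor_assoc_natural[OF assms(1-3)]
      tensor_map_comp[OF C C C C2 C C2 assms(4,5,1) map11_hom[OF assms(2,3)] assms(6)])

text \<open>Naturality of \<tau>, applied in the first factor of
  \<open>(C \<otimes> C) \<otimes> C\<close>. It carries \<open>R\<close> from the second tensor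
  slot to the first in condition (iii).\<close>

lemma swap_id_map111:
  assumes f: "f \<in> module_hom F C C" and g: "g \<in> module_hom F C C" and h: "h \<in> module_hom F C C"
    and X: "X \<in> carrier (tensor3 F C)"
  shows "swap_id F C (map111 F C f g h X) = map111 F C g f h (swap_id F C X)"
proof -
  note s = tensor_swap(1)[OF C C]
  have "tensor_swap F C C (map11 F C f g w) = map11 F C g f (tensor_swap F C C w)"
    if "w \<in> carrier (tensor2 F C)" for w
    unfolding map11_def by (rule tensor_swap_tensor_map[OF C C C C f g that])
  then have "tensor_map F (tensor2 F C) C (tensor2 F C) C (\<lambda>w. tensor_swap F C C (map11 F C f g w)) h
    = tensor_map F (tensor2 F C) C (tensor2 F C) C (\<lambda>w. map11 F C g f (tensor_swap F C C w)) h"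
    by (intro tensor_map_cong) simp_all
  then show ?thesis
    unfolding swap_id_def map111_def
    by (simp add: tensor_map_comp[OF C2 C C2 C C2 C map11_hom[OF f g] h s module_hom_ident X]
        tensor_map_comp[OF C2 C C2 C C2 C s module_hom_ident map11_hom[OF g f] h X])
qed

section \<open>Cyclic permutations and transpositions on the triple tensor power\<close>

lemma tensor_cyc_assoc:
  assumes x: "x \<in> carrier C" and w: "w \<in> carrier (tensor2 F C)"
  shows "tensor_cyc F C (tensor_assoc F C (tens F C (tensor2 F C) x w)) = tens F (tensor2 F C) C w x"
proof -
  \<comment> \<open>The element \<open>w\<close> is left arbitrary because values of a cobracket
    need not be pure tensors; \<open>t\<close> and \<open>t'\<close> make both sides linear in
    \<open>w\<close>.\<close>
  note t = bspec[OF conjunct2[OF tens_bilinear[OF C C2, unfolded bilinear_map_def]] x]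
  note t' = bspec[OF conjunct1[OF tens_bilinear[OF C2 C, unfolded bilinear_map_def]] x]
  show ?thesis
    by (rule tensor_hom_eqI[OF C C C3 module_hom_comp[OF tensor_cyc(1)[OF C]
          module_hom_comp[OF tensor_assoc(1)[OF C] t]] t' _ w])
      (simp add: x tensor_assoc(2)[OF C] tensor_cyc(2)[OF C], simp add: tens3_def)
qed

text \<open>As permutations of three factors, \<open>\<tau> \<otimes> I\<close> is
  \<open>\<xi>\<^sup>2\<close> after \<open>I \<otimes> \<tau>\<close>: the latter sends
  \<open>x \<otimes> y \<otimes> z\<close> to \<open>x \<otimes> z \<otimes> y\<close>, and two
  cyclic shifts lead through \<open>z \<otimes> y \<otimes> x\<close> to
  \<open>y \<otimes> x \<otimes> z\<close>.\<close>

lemma swap_id_assoc: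
  assumes x: "x \<in> carrier C" and w: "w \<in> carrier (tensor2 F C)"
  shows "swap_id F C (tensor_assoc F C (tens F C (tensor2 F C) x w)) =
    tensor_cyc F C (tensor_cyc F C (tensor_assoc F C (tens F C (tensor2 F C) x (tensor_swap F C C w))))"
proof -
  note t = bspec[OF conjunct2[OF tens_bilinear[OF C C2, unfolded bilinear_map_def]] x]
  note s = tensor_swap[OF C C]
  have sw: "swap_id F C (tens3 F C a b c) = tens3 F C b a c"
    if "a \<in> carrier C" "b \<in> carrier C" "c \<in> carrier C" for a b c
    unfolding swap_id_def tens3_def using that
    by (simp add: tensor_map(2)[OF C2 C C2 C s(1) module_hom_ident] tens_closed[OF C C] s(2))
  show ?thesis
    by (rule tensor_hom_eqI[OF C C C3 module_hom_comp[OF swap_id_hom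
          module_hom_comp[OF tensor_assoc(1)[OF C] t]]
          module_hom_comp[OF tensor_cyc(1)[OF C] module_hom_comp[OF tensor_cyc(1)[OF C]
          module_hom_comp[OF tensor_assoc(1)[OF C] module_hom_comp[OF t s(1)]]]] _ w])
      (simp add: x s(2) tensor_assoc(2)[OF C] tensor_cyc(2)[OF C] sw)
qed

text \<open>On \<open>u \<otimes> v\<close> both sides are \<open>f v \<otimes> g u\<close>, because
  \<xi> moves the single factor \<open>g u\<close> behind the pair \<open>f v\<close>. With
  antisymmetry this makes \<open>\<gamma> \<otimes> \<alpha>\<close> comparable with
  \<open>\<alpha> \<otimes> \<gamma>\<close>.\<close>

lemma map21_swap:
  assumes f: "f \<in> module_hom F C (tensor2 F C)" and g: "g \<in> module_hom F C C"
    and X: "X \<in> carrier (tensor2 F C)"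
  shows "map21 F C f g (tensor_swap F C C X) = tensor_cyc F C (map12 F C g f X)"
proof -
  note s = tensor_swap[OF C C]
  show ?thesis
    by (rule tensor_hom_eqI[OF C C C3 module_hom_comp[OF map21_hom[OF f g] s(1)]
          module_hom_comp[OF tensor_cyc(1)[OF C] map12_hom[OF g f]] _ X])
      (simp add: map12_def map21_def s(2) tensor_map(2)[OF C C C2 C f g]
        tensor_map(2)[OF C C C C2 g f] tensor_cyc_assoc module_hom_image[OF f] module_hom_image[OF g])
qed

text \<open>On a pure tensor \<open>u \<otimes> v\<close> this is \<open>swap_id_assoc\<close> with
  \<open>w = f v\<close>. The swap lands on the inner map \<open>f\<close>, where antisymmetry can
  absorb it.\<close>

lemma swap_id_map12:
  assumes f: "f \<in> module_hom F C (tensor2 F C)" and g: "g \<in> module_hom F C C"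
    and X: "X \<in> carrier (tensor2 F C)"
  shows "swap_id F C (map12 F C g f X) =
    tensor_cyc F C (tensor_cyc F C (map12 F C g (\<lambda>x. tensor_swap F C C (f x)) X))"
proof -
  note sf = module_hom_comp[OF tensor_swap(1)[OF C C] f]
  show ?thesis
    by (rule tensor_hom_eqI[OF C C C3 module_hom_comp[OF swap_id_hom map12_hom[OF g f]]
          module_hom_comp[OF tensor_cyc(1)[OF C] module_hom_comp[OF tensor_cyc(1)[OF C]
            map12_hom[OF g sf]]] _ X])
      (simp add: map12_def tensor_map(2)[OF C C C C2 g f]
        tensor_map(2)[OF C C C C2 g sf] swap_id_assoc module_hom_image[OF f] module_hom_image[OF g])
qed

section \<open>Congruence and linearity of \<open>map21\<close> and \<open>map12\<close> in their
  arguments\<close>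

lemma map21_cong:
  "(\<And>x. x \<in> carrier C \<Longrightarrow> f x = f' x) \<Longrightarrow> (\<And>x. x \<in> carrier C \<Longrightarrow> g x = g' x) \<Longrightarrow>
    map21 F C f g = map21 F C f' g'"
  unfolding map21_def by (rule tensor_map_cong)

lemma map12_cong:
  assumes "\<And>x. x \<in> carrier C \<Longrightarrow> f x = f' x" "\<And>x. x \<in> carrier C \<Longrightarrow> g x = g' x"
  shows "map12 F C f g = map12 F C f' g'"
  unfolding map12_def by (subst tensor_map_cong[OF assms]) simp_all

lemma map21_add_left:
  assumes "f \<in> module_hom F C (tensor2 F C)" "f' \<in> module_hom F C (tensor2 F C)"
    and "g \<in> module_hom F C C" "X \<in> carrier (tensor2 F C)"
  shows "map21 F C (\<lambda>x. f x \<oplus>\<^bsub>tensor2 F C\<^esub> f' x) g X =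
    map21 F C f g X \<oplus>\<^bsub>tensor3 F C\<^esub> map21 F C f' g X"
  unfolding map21_def by (rule tensor_map_add_left[OF C C C2 C assms])

lemma map21_smult_left:
  assumes "k \<in> carrier F" "f \<in> module_hom F C (tensor2 F C)" "g \<in> module_hom F C C"
    and "X \<in> carrier (tensor2 F C)"
  shows "map21 F C (\<lambda>x. k \<odot>\<^bsub>tensor2 F C\<^esub> f x) g X = k \<odot>\<^bsub>tensor3 F C\<^esub> map21 F C f g X"
  unfolding map21_def by (rule tensor_map_smult_left[OF C C C2 C assms])

lemma map12_smult_right:
  assumes "k \<in> carrier F" "f \<in> module_hom F C C" "g \<in> module_hom F C (tensor2 F C)"
    and "X \<in> carrier (tensor2 F C)"
  shows "map12 F C f (\<lambda>x. k \<odot>\<^bsub>tensor2 F C\<^esub> g x) X = k \<odot>\<^bsub>tensor3 F C\<^esub> map12 F C f g X"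
  unfolding map12_def comp_def
  using module_hom_image[OF tensor_map(1)[OF C C C C2 assms(2,3)] assms(4)] assms(1)
  by (simp add: tensor_map_smult_right[OF C C C C2 assms] module_hom_smult[OF tensor_assoc(1)[OF C]])

end


section \<open>Rota-Baxter Hom-Lie coalgebras\<close>

lemma linear_map_iff_module_hom:
  "vectorspace F V \<Longrightarrow> vectorspace F W \<Longrightarrow> linear_map F V W f \<longleftrightarrow> f \<in> module_hom F V W"
  by (simp add: linear_map_def mod_hom_def mod_hom_axioms_def vectorspace_def)

section \<open>Consequences of the Hom-Lie axioms\<close>

context hom_lie_coalgebra
begin

lemmas C_vs = vectorspace_axioms
lemmas C2_vs = tensor_vectorspace[OF C_vs C_vs]
lemmas C3_vs = tensor_vectorspace[OF C2_vs C_vs]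
lemmas C2_mod = vectorspace_imp_module[OF C2_vs]
lemmas C3_mod = vectorspace_imp_module[OF C3_vs]

lemma \<gamma>_hom: "\<gamma> \<in> module_hom F C (tensor2 F C)"
  using linear_\<gamma> linear_map_iff_module_hom[OF C_vs C2_vs] by blast

lemma \<alpha>_hom: "\<alpha> \<in> module_hom F C C"
  using linear_\<alpha> linear_map_iff_module_hom[OF C_vs C_vs] by blast

text \<open>Antisymmetry solved for the swapped side. The sign is kept as a scalar because that form
  passes through \<open>map12\<close> and \<open>map21\<close>.\<close>

lemma swap_\<gamma>:
  assumes x: "x \<in> carrier C"
  shows "tensor_swap F C C (\<gamma> x) = (\<ominus>\<^bsub>F\<^esub> \<one>\<^bsub>F\<^esub>) \<odot>\<^bsub>tensor2 F C\<^esub> \<gamma> x"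
proof -
  interpret T: Module.module F "tensor2 F C" by (rule C2_mod)
  have cl: "tensor_swap F C C (\<gamma> x) \<in> carrier (tensor2 F C)"
    by (rule module_hom_image[OF tensor_swap(1)[OF C_vs C_vs] module_hom_image[OF \<gamma>_hom x]])
  have "\<gamma> x = \<ominus>\<^bsub>tensor2 F C\<^esub> tensor_swap F C C (\<gamma> x)" by (rule antisym[OF x])
  then have "tensor_swap F C C (\<gamma> x) = \<ominus>\<^bsub>tensor2 F C\<^esub> \<gamma> x"
    using T.M.minus_minus[OF cl] by simp
  then show ?thesis
    using module_uminus_smult[OF C2_mod module_hom_image[OF \<gamma>_hom x]] by simp
qed

text \<open>This is condition (iii) with \<gamma> in place of \<Delta>, the only form in which the
  Hom-Jacobi identity is used for (iii) and (iv).\<close>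

lemma hom_jacobi_coaction:
  assumes x: "x \<in> carrier C"
  shows "map12 F C \<alpha> \<gamma> (\<gamma> x) \<ominus>\<^bsub>tensor3 F C\<^esub> map21 F C \<gamma> \<alpha> (\<gamma> x)
    \<ominus>\<^bsub>tensor3 F C\<^esub> swap_id F C (map12 F C \<alpha> \<gamma> (\<gamma> x)) = \<zero>\<^bsub>tensor3 F C\<^esub>"
proof -
  interpret T: Module.module F "tensor3 F C" by (rule C3_mod)
  define y where "y = map12 F C \<alpha> \<gamma> (\<gamma> x)"
  let ?m = "\<ominus>\<^bsub>F\<^esub> \<one>\<^bsub>F\<^esub>"
  note gx = module_hom_image[OF \<gamma>_hom x]
  note cyc = tensor_cyc(1)[OF C_vs]
  have m: "?m \<in> carrier F" by simp
  have y: "y \<in> carrier (tensor3 F C)"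
    unfolding y_def by (rule module_hom_image[OF map12_hom[OF C_vs \<alpha>_hom \<gamma>_hom] gx])
  note cy = module_hom_image[OF cyc y] and ccy = module_hom_image[OF cyc module_hom_image[OF cyc y]]
  \<comment> \<open>Antisymmetry of the cobracket that is applied first, to \<open>x\<close>
    itself.\<close>
  have "tensor_cyc F C y = map21 F C \<gamma> \<alpha> (tensor_swap F C C (\<gamma> x))"
    unfolding y_def by (rule map21_swap[OF C_vs \<gamma>_hom \<alpha>_hom gx, symmetric])
  also have "\<dots> = \<ominus>\<^bsub>tensor3 F C\<^esub> map21 F C \<gamma> \<alpha> (\<gamma> x)"
    using module_hom_image[OF map21_hom[OF C_vs \<gamma>_hom \<alpha>_hom] gx]
    by (simp add: swap_\<gamma>[OF x] module_hom_smult[OF map21_hom[OF C_vs \<gamma>_hom \<alpha>_hom] m gx]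
        module_uminus_smult[OF C3_mod])
  finally have 1: "\<ominus>\<^bsub>tensor3 F C\<^esub> map21 F C \<gamma> \<alpha> (\<gamma> x) = tensor_cyc F C y" by simp
  \<comment> \<open>Antisymmetry of the second cobracket, inside the right tensor factor.\<close>
  have "map12 F C \<alpha> (\<lambda>x. tensor_swap F C C (\<gamma> x)) = map12 F C \<alpha> (\<lambda>x. ?m \<odot>\<^bsub>tensor2 F C\<^esub> \<gamma> x)"
    by (rule map12_cong[OF C_vs]) (simp_all add: swap_\<gamma>)
  then have "swap_id F C y = tensor_cyc F C (tensor_cyc F C (?m \<odot>\<^bsub>tensor3 F C\<^esub> y))"
    unfolding y_def
    by (simp add: swap_id_map12[OF C_vs \<gamma>_hom \<alpha>_hom gx]
        map12_smult_right[OF C_vs m \<alpha>_hom \<gamma>_hom gx])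
  also have "\<dots> = \<ominus>\<^bsub>tensor3 F C\<^esub> tensor_cyc F C (tensor_cyc F C y)"
    using y cy ccy by (simp add: module_hom_smult[OF cyc] module_uminus_smult[OF C3_mod])
  finally have 2: "\<ominus>\<^bsub>tensor3 F C\<^esub> swap_id F C y = tensor_cyc F C (tensor_cyc F C y)"
    using ccy by simp
  show ?thesis
    using hom_jacobi[OF x] 1 2 by (simp add: a_minus_def y_def[symmetric] Let_def)
qed

lemma scaled_hom_lie_coalgebra:
  assumes k: "k \<in> carrier F"
  shows "hom_lie_coalgebra F C (\<lambda>x. k \<odot>\<^bsub>tensor2 F C\<^esub> \<gamma> x) \<alpha>"
proof (intro hom_lie_coalgebra.intro hom_lie_coalgebra_axioms.intro char_0_vectorspace_axioms)
  interpret T2: Module.module F "tensor2 F C" by (rule C2_mod)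
  interpret T3: Module.module F "tensor3 F C" by (rule C3_mod)
  note swap = tensor_swap(1)[OF C_vs C_vs] and cyc = tensor_cyc(1)[OF C_vs]
  show "linear_map F C (tensor2 F C) (\<lambda>x. k \<odot>\<^bsub>tensor2 F C\<^esub> \<gamma> x)"
    unfolding linear_map_iff_module_hom[OF C_vs C2_vs]
    by (rule module_hom_scale[OF C2_mod \<gamma>_hom k])
  show "linear_map F C C \<alpha>" by (rule linear_\<alpha>)
  fix x assume x: "x \<in> carrier C"
  note gx = module_hom_image[OF \<gamma>_hom x]
  show "k \<odot>\<^bsub>tensor2 F C\<^esub> \<gamma> x =
      \<ominus>\<^bsub>tensor2 F C\<^esub> tensor_swap F C C (k \<odot>\<^bsub>tensor2 F C\<^esub> \<gamma> x)"
    using antisym[OF x] module_hom_image[OF swap gx] k gx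
    by (metis module_hom_smult[OF swap] T2.smult_r_minus)
  show "k \<odot>\<^bsub>tensor2 F C\<^esub> \<gamma> (\<alpha> x) = map11 F C \<alpha> \<alpha> (k \<odot>\<^bsub>tensor2 F C\<^esub> \<gamma> x)"
    by (simp add: comult[OF x] module_hom_smult[OF map11_hom[OF C_vs \<alpha>_hom \<alpha>_hom] k gx])
  define y where "y = map12 F C \<alpha> \<gamma> (\<gamma> x)"
  have y: "y \<in> carrier (tensor3 F C)"
    unfolding y_def by (rule module_hom_image[OF map12_hom[OF C_vs \<alpha>_hom \<gamma>_hom] gx])
  note cy = module_hom_image[OF cyc y] and ccy = module_hom_image[OF cyc module_hom_image[OF cyc y]]
  have kk: "k \<otimes>\<^bsub>F\<^esub> k \<in> carrier F" using k by simp
  have "map12 F C \<alpha> (\<lambda>x. k \<odot>\<^bsub>tensor2 F C\<^esub> \<gamma> x) (k \<odot>\<^bsub>tensor2 F C\<^esub> \<gamma> x)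
      = (k \<otimes>\<^bsub>F\<^esub> k) \<odot>\<^bsub>tensor3 F C\<^esub> y"
    using k gx y T2.smult_closed[OF k gx]
    by (simp add: map12_smult_right[OF C_vs k \<alpha>_hom \<gamma>_hom]
        module_hom_smult[OF map12_hom[OF C_vs \<alpha>_hom \<gamma>_hom] k gx] y_def T3.smult_assoc1)
  moreover have "(k \<otimes>\<^bsub>F\<^esub> k) \<odot>\<^bsub>tensor3 F C\<^esub> (y \<oplus>\<^bsub>tensor3 F C\<^esub> tensor_cyc F C y
      \<oplus>\<^bsub>tensor3 F C\<^esub> tensor_cyc F C (tensor_cyc F C y)) = \<zero>\<^bsub>tensor3 F C\<^esub>"
    using hom_jacobi[OF x] kk by (simp add: y_def[symmetric] Let_def)
  ultimately show "(let y = map12 F C \<alpha> (\<lambda>x. k \<odot>\<^bsub>tensor2 F C\<^esub> \<gamma> x) (k \<odot>\<^bsub>tensor2 F C\<^esub> \<gamma> x)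
       in y \<oplus>\<^bsub>tensor3 F C\<^esub> tensor_cyc F C y \<oplus>\<^bsub>tensor3 F C\<^esub> tensor_cyc F C (tensor_cyc F C y))
        = \<zero>\<^bsub>tensor3 F C\<^esub>"
    using kk y cy ccy by (simp add: Let_def module_hom_smult[OF cyc] T3.smult_r_distr)
qed

end

section \<open>The coproduct \<open>(R \<otimes> I) \<circ> \<gamma>\<close> and conditions (iii)
  and (iv)\<close>

context rota_baxter_hom_lie_coalgebra
begin

lemma R_hom: "R \<in> module_hom F C C"
  using linear_R linear_map_iff_module_hom[OF C_vs C_vs] by blast

abbreviation "D x \<equiv> map11 F C R (\<lambda>z. z) (\<gamma> x)"

lemma D_hom: "D \<in> module_hom F C (tensor2 F C)"
  by (rule module_hom_comp[OF map11_hom[OF C_vs R_hom module_hom_ident] \<gamma>_hom])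

text \<open>Naturality of \<tau> moves \<open>R\<close> to the other factor and antisymmetry
  supplies the sign. In this way the summand \<open>(I \<otimes> R) \<circ> \<gamma>\<close> of the
  Rota-Baxter equation arises from a swapped term of (iv).\<close>

lemma swap_D:
  assumes x: "x \<in> carrier C"
  shows "tensor_swap F C C (D x) = (\<ominus>\<^bsub>F\<^esub> \<one>\<^bsub>F\<^esub>) \<odot>\<^bsub>tensor2 F C\<^esub> map11 F C (\<lambda>z. z) R (\<gamma> x)"
proof -
  note gx = module_hom_image[OF \<gamma>_hom x]
  have "tensor_swap F C C (D x) = map11 F C (\<lambda>z. z) R (tensor_swap F C C (\<gamma> x))"
    unfolding map11_def
    by (rule tensor_swap_tensor_map[OF C_vs C_vs C_vs C_vs R_hom module_hom_ident gx])
  then show ?thesis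
    using gx by (simp add: swap_\<gamma>[OF x] module_hom_smult[OF map11_hom[OF C_vs module_hom_ident R_hom]])
qed

lemma D_post1:
  assumes x: "x \<in> carrier C"
  shows "map12 F C \<alpha> (\<lambda>x. lam \<odot>\<^bsub>tensor2 F C\<^esub> \<gamma> x) (D x)
    \<ominus>\<^bsub>tensor3 F C\<^esub> map21 F C D \<alpha> (lam \<odot>\<^bsub>tensor2 F C\<^esub> \<gamma> x)
    \<ominus>\<^bsub>tensor3 F C\<^esub> swap_id F C (map12 F C \<alpha> D (lam \<odot>\<^bsub>tensor2 F C\<^esub> \<gamma> x)) = \<zero>\<^bsub>tensor3 F C\<^esub>"
proof -
  interpret T: Module.module F "tensor3 F C" by (rule C3_mod)
  note id = module_hom_ident[of F C]
  note gx = module_hom_image[OF \<gamma>_hom x] and Dx = module_hom_image[OF D_hom x]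
  \<comment> \<open>These are the three terms of \<open>hom_jacobi_coaction\<close>; each term of
    (iii) is shown to be the image of one of them under \<open>?N\<close>.\<close>
  define y c s where "y = map12 F C \<alpha> \<gamma> (\<gamma> x)" and "c = map21 F C \<gamma> \<alpha> (\<gamma> x)"
    and "s = swap_id F C (map12 F C \<alpha> \<gamma> (\<gamma> x))"
  let ?M = "map111 F C R (\<lambda>z. z) (\<lambda>z. z)"
  let ?N = "\<lambda>X. lam \<odot>\<^bsub>tensor3 F C\<^esub> ?M X"
  note M = map111_hom[OF C_vs R_hom id id]
  note N = module_hom_scale[OF C3_mod M weight]
  have y: "y \<in> carrier (tensor3 F C)"
    unfolding y_def by (rule module_hom_image[OF map12_hom[OF C_vs \<alpha>_hom \<gamma>_hom] gx])
  have c: "c \<in> carrier (tensor3 F C)"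
    unfolding c_def by (rule module_hom_image[OF map21_hom[OF C_vs \<gamma>_hom \<alpha>_hom] gx])
  have s: "s \<in> carrier (tensor3 F C)"
    unfolding s_def y_def[symmetric] by (rule module_hom_image[OF swap_id_hom[OF C_vs] y])
  \<comment> \<open>Commuting \<open>R\<close> past \<alpha> makes it the last map applied in its
    slot; the identity on the right factor is inserted to match \<open>map111_map12\<close>.\<close>
  have "map12 F C (\<lambda>x. \<alpha> (R x)) \<gamma> =
      map12 F C (\<lambda>x. R (\<alpha> x)) (\<lambda>x. map11 F C (\<lambda>z. z) (\<lambda>z. z) (\<gamma> x))"
    by (rule map12_cong[OF C_vs]) (simp_all add: R_\<alpha> map11_ident[OF C_vs] module_hom_image[OF \<gamma>_hom])
  then have "map12 F C \<alpha> \<gamma> (D x) = ?M y"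
    unfolding y_def
    by (simp add: map12_map11[OF C_vs \<alpha>_hom \<gamma>_hom R_hom id gx]
        map111_map12[OF C_vs R_hom id id \<alpha>_hom \<gamma>_hom gx])
  then have 1: "map12 F C \<alpha> (\<lambda>x. lam \<odot>\<^bsub>tensor2 F C\<^esub> \<gamma> x) (D x) = ?N y"
    by (simp add: map12_smult_right[OF C_vs weight \<alpha>_hom \<gamma>_hom Dx])
  have 2: "map21 F C D \<alpha> (lam \<odot>\<^bsub>tensor2 F C\<^esub> \<gamma> x) = ?N c"
    unfolding c_def
    by (simp add: map111_map21[OF C_vs R_hom id id \<gamma>_hom \<alpha>_hom gx]
        module_hom_smult[OF map21_hom[OF C_vs D_hom \<alpha>_hom] weight gx])
  \<comment> \<open>Here \<open>R\<close> acts in the second slot; \<open>\<tau> \<otimes> I\<close>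
    then brings it to the first, as \<open>?M\<close> requires.\<close>
  have "map12 F C \<alpha> D (\<gamma> x) = map111 F C (\<lambda>z. z) R (\<lambda>z. z) y"
    unfolding y_def by (simp add: map111_map12[OF C_vs id R_hom id \<alpha>_hom \<gamma>_hom gx])
  then have "swap_id F C (map12 F C \<alpha> D (\<gamma> x)) = ?M s"
    using swap_id_map111[OF C_vs id R_hom id y] by (simp add: s_def y_def)
  then have 3: "swap_id F C (map12 F C \<alpha> D (lam \<odot>\<^bsub>tensor2 F C\<^esub> \<gamma> x)) = ?N s"
    using module_hom_image[OF map12_hom[OF C_vs \<alpha>_hom D_hom] gx]
    by (simp add: module_hom_smult[OF map12_hom[OF C_vs \<alpha>_hom D_hom] weight gx]
        module_hom_smult[OF swap_id_hom[OF C_vs] weight])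
  have "?N y \<ominus>\<^bsub>tensor3 F C\<^esub> ?N c \<ominus>\<^bsub>tensor3 F C\<^esub> ?N s = ?N (y \<ominus>\<^bsub>tensor3 F C\<^esub> c \<ominus>\<^bsub>tensor3 F C\<^esub> s)"
    using module_hom_minus[OF C3_mod C3_mod N T.M.minus_closed[OF y c] s]
      module_hom_minus[OF C3_mod C3_mod N y c] by simp
  also have "\<dots> = \<zero>\<^bsub>tensor3 F C\<^esub>"
    using hom_jacobi_coaction[OF x] module_hom_zero[OF C3_mod C3_mod N]
    by (simp add: y_def c_def s_def)
  finally show ?thesis by (simp only: 1 2 3)
qed

lemma D_post2:
  assumes x: "x \<in> carrier C"
  shows "map21 F C D \<alpha> (D x) \<ominus>\<^bsub>tensor3 F C\<^esub> map12 F C \<alpha> D (D x)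
    \<ominus>\<^bsub>tensor3 F C\<^esub> swap_id F C (map21 F C D \<alpha> (D x))
    \<oplus>\<^bsub>tensor3 F C\<^esub> swap_id F C (map12 F C \<alpha> D (D x))
    \<oplus>\<^bsub>tensor3 F C\<^esub> map21 F C (\<lambda>x. lam \<odot>\<^bsub>tensor2 F C\<^esub> \<gamma> x) \<alpha> (D x) = \<zero>\<^bsub>tensor3 F C\<^esub>"
proof -
  interpret T: Module.module F "tensor3 F C" by (rule C3_mod)
  note id = module_hom_ident[of F C]
  note gx = module_hom_image[OF \<gamma>_hom x]
  define y c s where "y = map12 F C \<alpha> \<gamma> (\<gamma> x)" and "c = map21 F C \<gamma> \<alpha> (\<gamma> x)"
    and "s = swap_id F C (map12 F C \<alpha> \<gamma> (\<gamma> x))"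
  let ?M = "map111 F C R R (\<lambda>z. z)"
  let ?E = "\<lambda>x. map11 F C (\<lambda>z. z) R (\<gamma> x)"
  note M = map111_hom[OF C_vs R_hom R_hom id]
  note E = module_hom_comp[OF map11_hom[OF C_vs id R_hom] \<gamma>_hom]
  note lg = module_hom_scale[OF C2_mod \<gamma>_hom weight]
  note DR = module_hom_comp[OF D_hom R_hom] and ER = module_hom_comp[OF E R_hom]
    and lgR = module_hom_comp[OF lg R_hom]
  have y: "y \<in> carrier (tensor3 F C)"
    unfolding y_def by (rule module_hom_image[OF map12_hom[OF C_vs \<alpha>_hom \<gamma>_hom] gx])
  have c: "c \<in> carrier (tensor3 F C)"
    unfolding c_def by (rule module_hom_image[OF map21_hom[OF C_vs \<gamma>_hom \<alpha>_hom] gx])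
  have s: "s \<in> carrier (tensor3 F C)"
    unfolding s_def y_def[symmetric] by (rule module_hom_image[OF swap_id_hom[OF C_vs] y])
  \<comment> \<open>The three summands on the right of the Rota-Baxter equation, each tensored with
    \<alpha>. They come from the first, third (up to sign) and last terms of (iv).\<close>
  define p q r where "p = map21 F C (\<lambda>x. D (R x)) \<alpha> (\<gamma> x)" and "q = map21 F C (\<lambda>x. ?E (R x)) \<alpha> (\<gamma> x)"
    and "r = map21 F C (\<lambda>x. lam \<odot>\<^bsub>tensor2 F C\<^esub> \<gamma> (R x)) \<alpha> (\<gamma> x)"
  have pqr: "p \<in> carrier (tensor3 F C)" "q \<in> carrier (tensor3 F C)" "r \<in> carrier (tensor3 F C)"
    unfolding p_def q_def r_def
    by (rule module_hom_image[OF map21_hom[OF C_vs _ \<alpha>_hom] gx], rule DR ER lgR)+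
  have 1: "map21 F C D \<alpha> (D x) = p"
    unfolding p_def by (rule map21_map11[OF C_vs D_hom \<alpha>_hom R_hom id gx])
  have 5: "map21 F C (\<lambda>x. lam \<odot>\<^bsub>tensor2 F C\<^esub> \<gamma> x) \<alpha> (D x) = r"
    unfolding r_def by (rule map21_map11[OF C_vs lg \<alpha>_hom R_hom id gx])
  \<comment> \<open>The outer \<open>D\<close> puts \<open>R\<close> in the first slot, where it
    commutes with \<alpha>; the inner one puts \<open>R\<close> in the second.\<close>
  have "map12 F C (\<lambda>x. \<alpha> (R x)) D = map12 F C (\<lambda>x. R (\<alpha> x)) D"
    by (rule map12_cong[OF C_vs]) (simp_all add: R_\<alpha>)
  then have 2: "map12 F C \<alpha> D (D x) = ?M y"
    unfolding y_def
    by (simp add: map12_map11[OF C_vs \<alpha>_hom D_hom R_hom id gx]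
        map111_map12[OF C_vs R_hom R_hom id \<alpha>_hom \<gamma>_hom gx])
  \<comment> \<open>Interchanging the first two maps of \<open>R \<otimes> R \<otimes> I\<close>
    changes nothing, so this operator commutes with \<open>\<tau> \<otimes> I\<close>.\<close>
  have 4: "swap_id F C (map12 F C \<alpha> D (D x)) = ?M s"
    unfolding 2 swap_id_map111[OF C_vs R_hom R_hom id y] by (simp add: s_def y_def)
  have "map21 F C (\<lambda>x. tensor_swap F C C (D (R x))) \<alpha>
      = map21 F C (\<lambda>x. (\<ominus>\<^bsub>F\<^esub> \<one>\<^bsub>F\<^esub>) \<odot>\<^bsub>tensor2 F C\<^esub> ?E (R x)) \<alpha>"
    by (rule map21_cong[OF C_vs]) (simp_all add: swap_D module_hom_image[OF R_hom])
  then have 3: "swap_id F C (map21 F C D \<alpha> (D x)) = \<ominus>\<^bsub>tensor3 F C\<^esub> q"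
    unfolding module_uminus_smult[OF C3_mod pqr(2)] unfolding 1 p_def q_def
    by (simp add: swap_id_map21[OF C_vs DR \<alpha>_hom gx] map21_smult_left[OF C_vs _ ER \<alpha>_hom gx])
  have "p \<oplus>\<^bsub>tensor3 F C\<^esub> q \<oplus>\<^bsub>tensor3 F C\<^esub> r =
      map21 F C (\<lambda>x. D (R x) \<oplus>\<^bsub>tensor2 F C\<^esub> ?E (R x) \<oplus>\<^bsub>tensor2 F C\<^esub> lam \<odot>\<^bsub>tensor2 F C\<^esub> \<gamma> (R x)) \<alpha> (\<gamma> x)"
    unfolding p_def q_def r_def
    by (simp add: map21_add_left[OF C_vs DR ER \<alpha>_hom gx]
        map21_add_left[OF C_vs module_hom_plus[OF C2_mod DR ER] lgR \<alpha>_hom gx])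
  \<comment> \<open>The Rota-Baxter equation, read from right to left inside the first tensor
    factor.\<close>
  also have "\<dots> = map21 F C (\<lambda>x. map11 F C R R (\<gamma> x)) \<alpha> (\<gamma> x)"
    by (rule fun_cong[OF map21_cong[OF C_vs]]) (simp_all add: rota_baxter)
  also have "\<dots> = ?M c"
    unfolding c_def by (simp add: map111_map21[OF C_vs R_hom R_hom id \<gamma>_hom \<alpha>_hom gx])
  finally have pqr_M: "p \<oplus>\<^bsub>tensor3 F C\<^esub> q \<oplus>\<^bsub>tensor3 F C\<^esub> r = ?M c" .
  note Mcl = module_hom_image[OF M y] module_hom_image[OF M c] module_hom_image[OF M s]
  have "?M y \<ominus>\<^bsub>tensor3 F C\<^esub> ?M c \<ominus>\<^bsub>tensor3 F C\<^esub> ?M s = ?M (y \<ominus>\<^bsub>tensor3 F C\<^esub> c \<ominus>\<^bsub>tensor3 F C\<^esub> s)"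
    using module_hom_minus[OF C3_mod C3_mod M T.M.minus_closed[OF y c] s]
      module_hom_minus[OF C3_mod C3_mod M y c] by simp
  also have "\<dots> = \<zero>\<^bsub>tensor3 F C\<^esub>"
    using hom_jacobi_coaction[OF x] module_hom_zero[OF C3_mod C3_mod M]
    by (simp add: y_def c_def s_def)
  finally have zero: "?M y \<ominus>\<^bsub>tensor3 F C\<^esub> ?M c \<ominus>\<^bsub>tensor3 F C\<^esub> ?M s = \<zero>\<^bsub>tensor3 F C\<^esub>" .
  \<comment> \<open>The double sign turns the third term into \<open>+ q\<close>, which completes
    the sum \<open>p + q + r = ?M c\<close>; what remains is the negative of
    \<open>zero\<close>.\<close>
  have "p \<ominus>\<^bsub>tensor3 F C\<^esub> ?M y \<ominus>\<^bsub>tensor3 F C\<^esub> (\<ominus>\<^bsub>tensor3 F C\<^esub> q) \<oplus>\<^bsub>tensor3 F C\<^esub> ?M s \<oplus>\<^bsub>tensor3 F C\<^esub> r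
      = (p \<oplus>\<^bsub>tensor3 F C\<^esub> q \<oplus>\<^bsub>tensor3 F C\<^esub> r) \<ominus>\<^bsub>tensor3 F C\<^esub> ?M y \<oplus>\<^bsub>tensor3 F C\<^esub> ?M s"
    using pqr Mcl by (simp add: a_minus_def T.M.a_ac)
  also have "\<dots> = \<ominus>\<^bsub>tensor3 F C\<^esub> (?M y \<ominus>\<^bsub>tensor3 F C\<^esub> ?M c \<ominus>\<^bsub>tensor3 F C\<^esub> ?M s)"
    unfolding pqr_M using Mcl by (simp add: a_minus_def T.M.a_ac T.M.minus_add)
  also have "\<dots> = \<zero>\<^bsub>tensor3 F C\<^esub>" unfolding zero by simp
  \<comment> \<open>The left sides of \<open>3\<close> and \<open>4\<close> contain those of
    \<open>1\<close> and \<open>2\<close>; hence \<open>1\<close> is also applied inside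
    \<open>3\<close>, and \<open>2\<close> is read from right to left.\<close>
  finally show ?thesis by (simp only: 1 2[symmetric] 3[unfolded 1] 4 5)
qed

end

theorem proposition4p14:
  fixes F :: "('f, 'm) ring_scheme" and C :: "('f, 'c, 'n) module_scheme"
    and \<gamma> :: "'c \<Rightarrow> ('c \<times> 'c \<Rightarrow> 'f) set" and R \<alpha> :: "'c \<Rightarrow> 'c" and lam :: 'f
  assumes "rota_baxter_hom_lie_coalgebra F C \<gamma> R \<alpha> lam"
  shows "post_hom_lie_coalgebra F C
    (\<lambda>x. map11 F C R (\<lambda>z. z) (\<gamma> x)) (\<lambda>x. lam \<odot>\<^bsub>tensor2 F C\<^esub> \<gamma> x) \<alpha>"
proof -
  interpret rota_baxter_hom_lie_coalgebra F C \<gamma> R \<alpha> lam by fact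
  have "linear_map F C (tensor2 F C) D"
    unfolding linear_map_iff_module_hom[OF C_vs C2_vs] by (rule D_hom)
  then show ?thesis
    by (intro post_hom_lie_coalgebra.intro post_hom_lie_coalgebra_axioms.intro
        scaled_hom_lie_coalgebra[OF weight] D_post1 D_post2)
qed

end
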